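(* Let $\Omega\subseteq\mathbb{R}^d$, $d\ge2$, be an arbitrary bounded domain, $I=(0,T)$ with $0<T<\infty$, and $Q_T=I\times\Omega$. Let $G\subset\subset\Omega$ be a domain, $\eta\in C_0^\infty(\Omega)$ with $\eta\equiv1$ on $G$, let $\mathbf{A}\in\mathbb{R}^{d\times d}\setminus\{\mathbf{0}\}$ be skew-symmetric, and set $\mathbf{u}(x):=\eta(x)\mathbf{A}x$ for $x\in\Omega$. Then there exists a smooth, time-independent exponent $p\in C^\infty(\mathbb{R}^d)$ with $p^->1$ which does not admit a constant $c>0$ such that for every $\boldsymbol\phi\in C_0^\infty(Q_T)^d$ $$\|\nabla\boldsymbol\phi\|_{L^{p(\cdot)}(Q_T)^{d\times d}}\le c\,\|\boldsymbol\varepsilon(\boldsymbol\phi)\|_{L^{p(\cdot)}(Q_T)^{d\times d}} .$$ In particular, for every $\varphi\in L^{p^-}(I)\setminus L^{p^+}(I)$ there holds $\varphi\mathbf{u}\in\mathcal{X}^{p^-,p}_{\boldsymbol\varepsilon}(Q_T)\setminus\mathcal{X}^{p^-,p}_{\nabla}(Q_T)$, and $\mathcal{X}^{p^-,p}_{\boldsymbol\varepsilon}(Q_T)\neq\mathcal{X}^{p^-,p}_{\nabla}(Q_T)$.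
   Context: The exponent $p$ is extended constantly in time, $p(t,x):=p(x)$ on $Q_T$; $p^\pm$ are its (essential) supremum/infimum over $Q_T$. $\nabla$ and $\boldsymbol\varepsilon(\mathbf{v})=\frac12(\nabla\mathbf{v}+\nabla\mathbf{v}^\top)$ are with respect to the spatial variable $x$. $(\varphi\mathbf{u})(t,x):=\varphi(t)\mathbf{u}(x)$. For bounded measurable $p:G\to[1,\infty)$, $L^{p(\cdot)}(G)$ is the space of measurable $f$ with $\rho_{p(\cdot)}(f)=\int_G|f(x)|^{p(x)}dx<\infty$, with the Luxemburg norm $\|f\|_{L^{p(\cdot)}(G)}=\inf\{\lambda>0:\rho_{p(\cdot)}(f/\lambda)\le1\}$ (Euclidean/Frobenius norm for vector/matrix values). For bounded measurable exponents $q,p$ on $\Omega$, $X^{q(\cdot),p(\cdot)}_{\nabla}(\Omega)^d$ and $X^{q(\cdot),p(\cdot)}_{\boldsymbol\varepsilon}(\Omega)$ are the closures of $C_0^\infty(\Omega)^d$ with respect to $\|\mathbf{v}\|_{L^{q(\cdot)}(\Omega)^d}+\|\nabla\mathbf{v}\|_{L^{p(\cdot)}(\Omega)^{d\times d}}$ and $\|\mathbf{v}\|_{L^{q(\cdot)}(\Omega)^d}+\|\boldsymbol\varepsilon(\mathbf{v})\|_{L^{p(\cdot)}(\Omega)^{d\times d}}$, respectively (inside the spaces of all $\mathbf v\in L^{q(\cdot)}(\Omega)^d$ with distributional $\nabla\mathbf v$, respectively $\boldsymbol\varepsilon(\mathbf v)$, in $L^{p(\cdot)}$). Then $\mathcal{X}^{q,p}_{\nabla}(Q_T)=\{\boldsymbol{u}\in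 L^{q(\cdot,\cdot)}(Q_T)^d:\nabla\boldsymbol{u}\in L^{p(\cdot,\cdot)}(Q_T)^{d\times d},\ \boldsymbol{u}(t)\in X^{q(t,\cdot),p(t,\cdot)}_{\nabla}(\Omega)^d\text{ for a.e. }t\in I\}$ and $\mathcal{X}^{q,p}_{\boldsymbol\varepsilon}(Q_T)=\{\boldsymbol{u}\in L^{q(\cdot,\cdot)}(Q_T)^d:\boldsymbol\varepsilon(\boldsymbol{u})\in L^{p(\cdot,\cdot)}(Q_T)^{d\times d},\ \boldsymbol{u}(t)\in X^{q(t,\cdot),p(t,\cdot)}_{\boldsymbol\varepsilon}(\Omega)\text{ for a.e. }t\in I\}$; here $q$ is the constant $p^-$. *)

theory Defs
  imports "HOL-Analysis.Analysis" "HOL-Probability.Essential_Supremum"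
begin

primrec Ck_on :: "nat \<Rightarrow> 'a::euclidean_space set \<Rightarrow> ('a \<Rightarrow> 'b::real_normed_vector) \<Rightarrow> bool" where
  "Ck_on 0 S f \<longleftrightarrow> continuous_on S f"
| "Ck_on (Suc k) S f \<longleftrightarrow>
     (\<forall>x\<in>S. f differentiable (at x)) \<and> (\<forall>h. Ck_on k S (\<lambda>x. frechet_derivative f (at x) h))"

definition Cinf_on :: "'a::euclidean_space set \<Rightarrow> ('a \<Rightarrow> 'b::real_normed_vector) \<Rightarrow> bool" where
  "Cinf_on S f \<longleftrightarrow> (\<forall>k. Ck_on k S f)"

text \<open>Elements of \<open>C\<^sub>0\<^sup>\<infinity>(S)\<close> are represented by their extension by zero to the whole space.\<close>

definition Cinf0 :: "'a::euclidean_space set \<Rightarrow> ('a \<Rightarrow> 'b::real_normed_vector) set" where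
  "Cinf0 S = {f. Cinf_on UNIV f \<and> compact (closure {x. f x \<noteq> 0}) \<and> closure {x. f x \<noteq> 0} \<subseteq> S}"

subsection \<open>Variable exponent Lebesgue spaces\<close>

text \<open>Function spaces over \<open>S\<close> are sets of total functions whose defining conditions depend only
  on the almost-everywhere class of the restriction to \<open>S\<close>. For matrices of type
  \<open>real^'d^'d\<close> the library norm is the Frobenius norm.\<close>

definition modular ::
  "'a::euclidean_space set \<Rightarrow> ('a \<Rightarrow> real) \<Rightarrow> ('a \<Rightarrow> 'b::real_normed_vector) \<Rightarrow> ennreal" where
  "modular S p f = (\<integral>\<^sup>+ x. ennreal (norm (f x) powr p x) \<partial>lebesgue_on S)"

definition Lvar ::
  "'a::euclidean_space set \<Rightarrow> ('a \<Rightarrow> real) \<Rightarrow> ('a \<Rightarrow> 'b::real_normed_vector) set" where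
  "Lvar S p = {f. f \<in> borel_measurable (lebesgue_on S) \<and> modular S p f < \<infinity>}"

definition lux_norm ::
  "'a::euclidean_space set \<Rightarrow> ('a \<Rightarrow> real) \<Rightarrow> ('a \<Rightarrow> 'b::real_normed_vector) \<Rightarrow> real" where
  "lux_norm S p f = Inf {l. 0 < l \<and> modular S p (\<lambda>x. f x /\<^sub>R l) \<le> 1}"

definition exp_plus :: "'a::euclidean_space set \<Rightarrow> ('a \<Rightarrow> real) \<Rightarrow> real" where
  "exp_plus S p = real_of_ereal (esssup (lebesgue_on S) (\<lambda>x. ereal (p x)))"

text \<open>The essential infimum, as minus the essential supremum of the negative.\<close>

definition exp_minus :: "'a::euclidean_space set \<Rightarrow> ('a \<Rightarrow> real) \<Rightarrow> real" where
  "exp_minus S p = real_of_ereal (- esssup (lebesgue_on S) (\<lambda>x. - ereal (p x)))"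

subsection \<open>Classical and distributional gradients\<close>

definition partial :: "'d::finite \<Rightarrow> (real^'d \<Rightarrow> real) \<Rightarrow> real^'d \<Rightarrow> real" where
  "partial j f x = frechet_derivative f (at x) (axis j 1)"

definition grad :: "(real^'d::finite \<Rightarrow> real^'d) \<Rightarrow> real^'d \<Rightarrow> real^'d^'d" where
  "grad v x = jacobian v (at x)"

definition sym_grad :: "(real^'d::finite \<Rightarrow> real^'d) \<Rightarrow> real^'d \<Rightarrow> real^'d^'d" where
  "sym_grad v x = (1/2) *\<^sub>R (grad v x + transpose (grad v x))"

text \<open>On space-time, all differential operators act on the spatial variable only.\<close>

definition st_partial :: "'d::finite \<Rightarrow> (real \<times> (real^'d) \<Rightarrow> real) \<Rightarrow> real \<times> (real^'d) \<Rightarrow> real" where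
  "st_partial j f = (\<lambda>(t, x). partial j (\<lambda>y. f (t, y)) x)"

definition st_grad :: "(real \<times> (real^'d::finite) \<Rightarrow> real^'d) \<Rightarrow> real \<times> (real^'d) \<Rightarrow> real^'d^'d" where
  "st_grad v = (\<lambda>(t, x). grad (\<lambda>y. v (t, y)) x)"

definition st_sym_grad :: "(real \<times> (real^'d::finite) \<Rightarrow> real^'d) \<Rightarrow> real \<times> (real^'d) \<Rightarrow> real^'d^'d" where
  "st_sym_grad v = (\<lambda>(t, x). sym_grad (\<lambda>y. v (t, y)) x)"

definition locally_integrable_on ::
  "('a::euclidean_space \<Rightarrow> 'b::euclidean_space) \<Rightarrow> 'a set \<Rightarrow> bool" (infixr \<open>locally'_integrable'_on\<close> 46) where
  "f locally_integrable_on S \<longleftrightarrow> (\<forall>K. compact K \<and> K \<subseteq> S \<longrightarrow> f absolutely_integrable_on K)"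

definition weak_grad ::
  "(real^'d::finite) set \<Rightarrow> (real^'d \<Rightarrow> real^'d) \<Rightarrow> (real^'d \<Rightarrow> real^'d^'d) \<Rightarrow> bool" where
  "weak_grad S v g \<longleftrightarrow> v locally_integrable_on S \<and> g locally_integrable_on S \<and>
     (\<forall>\<psi>\<in>Cinf0 S. \<forall>i j.
        (LINT x|lebesgue_on S. v x $ i * partial j \<psi> x) = - (LINT x|lebesgue_on S. g x $ i $ j * \<psi> x))"

definition weak_sym_grad ::
  "(real^'d::finite) set \<Rightarrow> (real^'d \<Rightarrow> real^'d) \<Rightarrow> (real^'d \<Rightarrow> real^'d^'d) \<Rightarrow> bool" where
  "weak_sym_grad S v e \<longleftrightarrow> v locally_integrable_on S \<and> e locally_integrable_on S \<and>
     (\<forall>\<psi>\<in>Cinf0 S. \<forall>i j.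
        (LINT x|lebesgue_on S. (1/2) * (v x $ i * partial j \<psi> x + v x $ j * partial i \<psi> x))
        = - (LINT x|lebesgue_on S. e x $ i $ j * \<psi> x))"

definition st_weak_grad ::
  "(real \<times> (real^'d::finite)) set \<Rightarrow> (real \<times> (real^'d) \<Rightarrow> real^'d) \<Rightarrow> (real \<times> (real^'d) \<Rightarrow> real^'d^'d) \<Rightarrow> bool" where
  "st_weak_grad Q v g \<longleftrightarrow> v locally_integrable_on Q \<and> g locally_integrable_on Q \<and>
     (\<forall>\<psi>\<in>Cinf0 Q. \<forall>i j.
        (LINT z|lebesgue_on Q. v z $ i * st_partial j \<psi> z) = - (LINT z|lebesgue_on Q. g z $ i $ j * \<psi> z))"

definition st_weak_sym_grad ::
  "(real \<times> (real^'d::finite)) set \<Rightarrow> (real \<times> (real^'d) \<Rightarrow> real^'d) \<Rightarrow> (real \<times> (real^'d) \<Rightarrow> real^'d^'d) \<Rightarrow> bool" where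
  "st_weak_sym_grad Q v e \<longleftrightarrow> v locally_integrable_on Q \<and> e locally_integrable_on Q \<and>
     (\<forall>\<psi>\<in>Cinf0 Q. \<forall>i j.
        (LINT z|lebesgue_on Q. (1/2) * (v z $ i * st_partial j \<psi> z + v z $ j * st_partial i \<psi> z))
        = - (LINT z|lebesgue_on Q. e z $ i $ j * \<psi> z))"

subsection \<open>The spaces over the domain and over the space-time cylinder\<close>

definition X_grad ::
  "(real^'d::finite) set \<Rightarrow> (real^'d \<Rightarrow> real) \<Rightarrow> (real^'d \<Rightarrow> real) \<Rightarrow> (real^'d \<Rightarrow> real^'d) set" where
  "X_grad \<Omega> q p = {v \<in> Lvar \<Omega> q. \<exists>g\<in>Lvar \<Omega> p. weak_grad \<Omega> v g \<and>
     (\<forall>e>0. \<exists>\<psi>\<in>Cinf0 \<Omega>.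
        lux_norm \<Omega> q (\<lambda>x. v x - \<psi> x) + lux_norm \<Omega> p (\<lambda>x. g x - grad \<psi> x) < e)}"

definition X_sym ::
  "(real^'d::finite) set \<Rightarrow> (real^'d \<Rightarrow> real) \<Rightarrow> (real^'d \<Rightarrow> real) \<Rightarrow> (real^'d \<Rightarrow> real^'d) set" where
  "X_sym \<Omega> q p = {v \<in> Lvar \<Omega> q. \<exists>g\<in>Lvar \<Omega> p. weak_sym_grad \<Omega> v g \<and>
     (\<forall>e>0. \<exists>\<psi>\<in>Cinf0 \<Omega>.
        lux_norm \<Omega> q (\<lambda>x. v x - \<psi> x) + lux_norm \<Omega> p (\<lambda>x. g x - sym_grad \<psi> x) < e)}"

definition calX_grad ::
  "real set \<Rightarrow> (real^'d::finite) set \<Rightarrow> (real \<times> (real^'d) \<Rightarrow> real) \<Rightarrow> (real \<times> (real^'d) \<Rightarrow> real)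
     \<Rightarrow> (real \<times> (real^'d) \<Rightarrow> real^'d) set" where
  "calX_grad I \<Omega> q p = {u \<in> Lvar (I \<times> \<Omega>) q.
     (\<exists>g\<in>Lvar (I \<times> \<Omega>) p. st_weak_grad (I \<times> \<Omega>) u g) \<and>
     (AE t in lebesgue_on I. (\<lambda>x. u (t, x)) \<in> X_grad \<Omega> (\<lambda>x. q (t, x)) (\<lambda>x. p (t, x)))}"

definition calX_sym ::
  "real set \<Rightarrow> (real^'d::finite) set \<Rightarrow> (real \<times> (real^'d) \<Rightarrow> real) \<Rightarrow> (real \<times> (real^'d) \<Rightarrow> real)
     \<Rightarrow> (real \<times> (real^'d) \<Rightarrow> real^'d) set" where
  "calX_sym I \<Omega> q p = {u \<in> Lvar (I \<times> \<Omega>) q.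
     (\<exists>g\<in>Lvar (I \<times> \<Omega>) p. st_weak_sym_grad (I \<times> \<Omega>) u g) \<and>
     (AE t in lebesgue_on I. (\<lambda>x. u (t, x)) \<in> X_sym \<Omega> (\<lambda>x. q (t, x)) (\<lambda>x. p (t, x)))}"

definition time_ext :: "('a \<Rightarrow> real) \<Rightarrow> real \<times> 'a \<Rightarrow> real" where
  "time_ext p = (\<lambda>(t, x). p x)"

end

theory Submission
  imports Defs "HOL-Real_Asymp.Real_Asymp"
begin

text \<open>
  On \<open>G\<close> the field \<open>u\<close> is the infinitesimal rotation \<open>A x\<close>, so \<open>\<epsilon>(u) = 0\<close> there while \<open>\<nabla>u = A\<close>.
  Choose a smooth exponent \<open>p\<close> with values in \<open>[2, 3]\<close>, equal to \<open>3\<close> on a small ball inside \<open>G\<close>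
  and to \<open>2\<close> outside a slightly larger one. The tensor product \<open>\<phi> u\<close> then only feels the
  exponent \<open>2\<close> through its symmetric gradient, but the exponent \<open>3\<close> through its gradient. Hence
  \<open>\<phi> \<in> L\<^sup>2\<close> suffices for \<open>\<phi> u\<close> to lie in the symmetric space, whereas membership in the
  gradient space forces \<open>\<phi> \<in> L\<^sup>3\<close>; and profiles concentrating in time contradict the
  gradient estimate.
\<close>

subsection \<open>Smooth functions\<close>

text \<open>Every field in the argument is a product \<open>\<phi> t *\<^sub>R v x\<close>, with
  \<open>v\<close> the zero extension of the given field. Its modular factors into a time part and a
  space part as soon as the exponent is constant where the space factor is nonzero; hence the demand
  that \<open>p\<close> equal its minimum wherever the symmetric gradient does not vanish. Each time
  slice is a multiple of a test function, so the two spaces are separated by integrability in time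
  alone. Any two values above 1 would serve as extremes; 2 and 3 keep the arithmetic short. Two
  obstacles shape the proof. The profile \<open>\<phi>\<close> has no regularity, and Lebesgue
  measure on the product is the completion of the product measure; so weak derivatives are obtained
  from translation invariance, and modulars from Borel representatives. Membership in the gradient
  space provides only some weak gradient, which must be identified almost everywhere with
  \<open>\<phi> t *\<^sub>R grad v x\<close> by the fundamental lemma.\<close>

lemma Ck_on_UNIV_SucI:
  assumes "\<And>x. (f has_derivative f' x) (at x)"
    and "\<And>h. Ck_on k UNIV (\<lambda>x. f' x h)"
  shows "Ck_on (Suc k) UNIV f"
proof -
  have "frechet_derivative f (at x) = f' x" for x
    using frechet_derivative_at[OF assms(1)] by simp
  moreover have "f differentiable (at x)" for x
    using assms(1) by (rule differentiableI)
  ultimately show ?thesis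
    using assms(2) by simp
qed

lemma Ck_on_UNIV_SucD:
  assumes "Ck_on (Suc k) UNIV f"
  shows "(f has_derivative frechet_derivative f (at x)) (at x)"
    and "Ck_on k UNIV (\<lambda>x. frechet_derivative f (at x) h)"
  using assms by (simp_all add: frechet_derivative_works)

lemma Ck_on_UNIV_continuous:
  "Ck_on k UNIV f \<Longrightarrow> continuous_on UNIV f"
proof (cases k)
  case (Suc n)
  assume "Ck_on k UNIV f"
  with Suc have "isCont f x" for x
    using has_derivative_continuous[OF Ck_on_UNIV_SucD(1)] by blast
  then show ?thesis by (simp add: continuous_at_imp_continuous_on)
qed simp

text \<open>\<open>Ck_on (Suc k)\<close> records differentiability and the order \<open>k\<close> of
  the derivatives, but not continuity of the function itself. That is recovered in the base case,
  since differentiable functions are continuous.\<close>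

lemma Ck_on_UNIV_lower:
  "Ck_on (Suc k) UNIV f \<Longrightarrow> Ck_on k UNIV f"
proof (induction k arbitrary: f)
  case 0
  then show ?case using Ck_on_UNIV_continuous[OF 0] by simp
next
  case (Suc k)
  show ?case
    by (rule Ck_on_UNIV_SucI[OF Ck_on_UNIV_SucD(1)[OF Suc.prems]])
      (rule Suc.IH[OF Ck_on_UNIV_SucD(2)[OF Suc.prems]])
qed

lemma Ck_on_UNIV_const: "Ck_on k UNIV (\<lambda>x. c)"
proof (induction k arbitrary: c)
  case (Suc k)
  show ?case by (rule Ck_on_UNIV_SucI[where f' = "\<lambda>_ _. 0"]) (auto intro: Suc)
qed simp

lemma Ck_on_UNIV_bounded_linear:
  assumes "bounded_linear f"
  shows "Ck_on k UNIV f"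
proof (cases k)
  case 0
  then show ?thesis using assms by (simp add: linear_continuous_on)
next
  case (Suc n)
  show ?thesis unfolding Suc
    by (rule Ck_on_UNIV_SucI[where f' = "\<lambda>_. f"])
      (auto intro: Ck_on_UNIV_const bounded_linear_imp_has_derivative assms)
qed

lemma Ck_on_UNIV_bounded_linear_compose:
  assumes "bounded_linear L"
  shows "Ck_on k UNIV f \<Longrightarrow> Ck_on k UNIV (\<lambda>x. L (f x))"
proof (induction k arbitrary: f)
  case 0
  then show ?case using bounded_linear.continuous_on[OF assms, of UNIV f] by simp
next
  case (Suc k)
  show ?case
  proof (rule Ck_on_UNIV_SucI)
    show "((\<lambda>x. L (f x)) has_derivative (\<lambda>h. L (frechet_derivative f (at x) h))) (at x)" for x
      by (rule bounded_linear.has_derivative[OF assms Ck_on_UNIV_SucD(1)[OF Suc.prems]])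
    show "Ck_on k UNIV (\<lambda>x. L (frechet_derivative f (at x) h))" for h
      by (rule Suc.IH[OF Ck_on_UNIV_SucD(2)[OF Suc.prems]])
  qed
qed

lemma Ck_on_UNIV_compose_bounded_linear:
  assumes "bounded_linear L"
  shows "Ck_on k UNIV f \<Longrightarrow> Ck_on k UNIV (\<lambda>x. f (L x))"
proof (induction k arbitrary: f)
  case 0
  then show ?case
    using continuous_on_compose2[of UNIV f UNIV L] linear_continuous_on[OF assms] by simp
next
  case (Suc k)
  show ?case
  proof (rule Ck_on_UNIV_SucI)
    show "((\<lambda>x. f (L x)) has_derivative (\<lambda>h. frechet_derivative f (at (L x)) (L h))) (at x)" for x
      by (rule has_derivative_compose[OF bounded_linear_imp_has_derivative[OF assms]
            Ck_on_UNIV_SucD(1)[OF Suc.prems]])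
    show "Ck_on k UNIV (\<lambda>x. frechet_derivative f (at (L x)) (L h))" for h
      by (rule Suc.IH[OF Ck_on_UNIV_SucD(2)[OF Suc.prems]])
  qed
qed

lemma Ck_on_UNIV_add:
  "Ck_on k UNIV f \<Longrightarrow> Ck_on k UNIV g \<Longrightarrow> Ck_on k UNIV (\<lambda>x. f x + g x)"
proof (induction k arbitrary: f g)
  case 0
  then show ?case by (simp add: continuous_on_add)
next
  case (Suc k)
  show ?case
    by (rule Ck_on_UNIV_SucI[OF has_derivative_add[OF Ck_on_UNIV_SucD(1)[OF Suc.prems(1)]
            Ck_on_UNIV_SucD(1)[OF Suc.prems(2)]]])
      (rule Suc.IH[OF Ck_on_UNIV_SucD(2)[OF Suc.prems(1)] Ck_on_UNIV_SucD(2)[OF Suc.prems(2)]])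
qed

text \<open>The product rule leaves one factor undifferentiated in each term, so the induction needs
  both the derivatives and the original functions at order \<open>k\<close>. Stated for a general
  bilinear map, one induction covers products, scalar multiples and inner products.\<close>

lemma Ck_on_UNIV_bilinear:
  assumes "bounded_bilinear B"
  shows "Ck_on k UNIV f \<Longrightarrow> Ck_on k UNIV g \<Longrightarrow> Ck_on k UNIV (\<lambda>x. B (f x) (g x))"
proof (induction k arbitrary: f g)
  case 0
  then show ?case by (simp add: bounded_bilinear.continuous_on[OF assms])
next
  case (Suc k)
  show ?case
  proof (rule Ck_on_UNIV_SucI)
    show "((\<lambda>x. B (f x) (g x)) has_derivative
        (\<lambda>h. B (f x) (frechet_derivative g (at x) h) + B (frechet_derivative f (at x) h) (g x))) (at x)" for x
      by (rule bounded_bilinear.FDERIV[OF assms Ck_on_UNIV_SucD(1)[OF Suc.prems(1)]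
            Ck_on_UNIV_SucD(1)[OF Suc.prems(2)]])
    show "Ck_on k UNIV (\<lambda>x. B (f x) (frechet_derivative g (at x) h) +
        B (frechet_derivative f (at x) h) (g x))" for h
      by (rule Ck_on_UNIV_add[OF
            Suc.IH[OF Ck_on_UNIV_lower[OF Suc.prems(1)] Ck_on_UNIV_SucD(2)[OF Suc.prems(2)]]
            Suc.IH[OF Ck_on_UNIV_SucD(2)[OF Suc.prems(1)] Ck_on_UNIV_lower[OF Suc.prems(2)]]])
  qed
qed

text \<open>The derivative of the reciprocal is a product of the reciprocal itself and the
  derivative of \<open>g\<close>, so the induction hypothesis for the same \<open>g\<close> closes
  the step.\<close>

lemma Ck_on_UNIV_inverse:
  fixes g :: "'a::euclidean_space \<Rightarrow> real"
  assumes "\<And>x. g x \<noteq> 0"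
  shows "Ck_on k UNIV g \<Longrightarrow> Ck_on k UNIV (\<lambda>x. inverse (g x))"
proof (induction k)
  case 0
  then show ?case using assms by (auto intro!: continuous_on_inverse)
next
  case (Suc k)
  show ?case
  proof (rule Ck_on_UNIV_SucI)
    show "((\<lambda>x. inverse (g x)) has_derivative
        (\<lambda>h. - (inverse (g x) * frechet_derivative g (at x) h * inverse (g x)))) (at x)" for x
      by (rule Deriv.has_derivative_inverse[OF assms Ck_on_UNIV_SucD(1)[OF Suc.prems]])
    show "Ck_on k UNIV (\<lambda>x. - (inverse (g x) * frechet_derivative g (at x) h * inverse (g x)))" for h
      by (intro Ck_on_UNIV_bounded_linear_compose[OF bounded_linear_minus[OF bounded_linear_ident]]
          Ck_on_UNIV_bilinear[OF bounded_bilinear_mult] Suc.IH Ck_on_UNIV_lower[OF Suc.prems]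
          Ck_on_UNIV_SucD(2)[OF Suc.prems])
  qed
qed

text \<open>In the chain rule the direction fed to the outer derivative varies with
  \<open>x\<close>, whereas the induction hypothesis concerns fixed directions. For an outer
  function on the reals, linearity pulls the direction out as a scalar factor, and the derivative
  becomes a product with the outer derivative in the fixed direction 1.\<close>

lemma Ck_on_UNIV_compose_real:
  fixes f :: "real \<Rightarrow> real"
  shows "Ck_on k UNIV f \<Longrightarrow> Ck_on k UNIV g \<Longrightarrow> Ck_on k UNIV (\<lambda>x. f (g x))"
proof (induction k arbitrary: f)
  case 0
  then show ?case
    using continuous_on_compose2[of UNIV f UNIV g] by simp
next
  case (Suc k)
  show ?case
  proof (rule Ck_on_UNIV_SucI)
    fix x
    have lin: "frechet_derivative f (at y) h = h * frechet_derivative f (at y) 1" for y h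
      using linear_cmul[OF has_derivative_linear[OF Ck_on_UNIV_SucD(1)[OF Suc.prems(1)]], of y h 1]
      by simp
    show "((\<lambda>x. f (g x)) has_derivative
        (\<lambda>h. frechet_derivative g (at x) h * frechet_derivative f (at (g x)) 1)) (at x)"
      unfolding lin[symmetric]
      by (rule has_derivative_compose[OF Ck_on_UNIV_SucD(1)[OF Suc.prems(2)]
            Ck_on_UNIV_SucD(1)[OF Suc.prems(1)]])
  next
    show "Ck_on k UNIV (\<lambda>x. frechet_derivative g (at x) h * frechet_derivative f (at (g x)) 1)" for h
      by (rule Ck_on_UNIV_bilinear[OF bounded_bilinear_mult Ck_on_UNIV_SucD(2)[OF Suc.prems(2)]
            Suc.IH[OF Ck_on_UNIV_SucD(2)[OF Suc.prems(1)] Ck_on_UNIV_lower[OF Suc.prems(2)]]])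
  qed
qed

lemma Cinf_on_UNIV_add:
  "Cinf_on UNIV f \<Longrightarrow> Cinf_on UNIV g \<Longrightarrow> Cinf_on UNIV (\<lambda>x. f x + g x)"
  by (simp add: Cinf_on_def Ck_on_UNIV_add)

lemma Cinf_on_UNIV_const: "Cinf_on UNIV (\<lambda>x. c)"
  by (simp add: Cinf_on_def Ck_on_UNIV_const)

lemma Cinf_on_UNIV_bounded_linear: "bounded_linear f \<Longrightarrow> Cinf_on UNIV f"
  by (simp add: Cinf_on_def Ck_on_UNIV_bounded_linear)

lemma Cinf_on_UNIV_bounded_linear_compose:
  "bounded_linear L \<Longrightarrow> Cinf_on UNIV f \<Longrightarrow> Cinf_on UNIV (\<lambda>x. L (f x))"
  by (simp add: Cinf_on_def Ck_on_UNIV_bounded_linear_compose)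

lemma Cinf_on_UNIV_compose_bounded_linear:
  "bounded_linear L \<Longrightarrow> Cinf_on UNIV f \<Longrightarrow> Cinf_on UNIV (\<lambda>x. f (L x))"
  by (simp add: Cinf_on_def Ck_on_UNIV_compose_bounded_linear)

lemma Cinf_on_UNIV_bilinear:
  "bounded_bilinear B \<Longrightarrow> Cinf_on UNIV f \<Longrightarrow> Cinf_on UNIV g \<Longrightarrow> Cinf_on UNIV (\<lambda>x. B (f x) (g x))"
  by (simp add: Cinf_on_def Ck_on_UNIV_bilinear)

lemmas Cinf_on_UNIV_mult = Cinf_on_UNIV_bilinear[OF bounded_bilinear_mult]
  and Cinf_on_UNIV_scaleR = Cinf_on_UNIV_bilinear[OF bounded_bilinear_scaleR]

lemma Cinf_on_UNIV_diff:
  "Cinf_on UNIV f \<Longrightarrow> Cinf_on UNIV g \<Longrightarrow> Cinf_on UNIV (\<lambda>x. f x - g x)"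
  using Cinf_on_UNIV_add[of f "\<lambda>x. - g x"]
    Cinf_on_UNIV_bounded_linear_compose[OF bounded_linear_minus[OF bounded_linear_ident], of g]
  by simp

lemma Cinf_on_UNIV_inverse:
  fixes g :: "'a::euclidean_space \<Rightarrow> real"
  shows "(\<And>x. g x \<noteq> 0) \<Longrightarrow> Cinf_on UNIV g \<Longrightarrow> Cinf_on UNIV (\<lambda>x. inverse (g x))"
  by (simp add: Cinf_on_def Ck_on_UNIV_inverse)

lemma Cinf_on_UNIV_compose_real:
  fixes f :: "real \<Rightarrow> real"
  shows "Cinf_on UNIV f \<Longrightarrow> Cinf_on UNIV g \<Longrightarrow> Cinf_on UNIV (\<lambda>x. f (g x))"
  by (simp add: Cinf_on_def Ck_on_UNIV_compose_real)

lemma Cinf_on_UNIV_prod: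
  fixes f :: "'i \<Rightarrow> 'a::euclidean_space \<Rightarrow> real"
  assumes "\<And>i. i \<in> S \<Longrightarrow> Cinf_on UNIV (f i)"
  shows "Cinf_on UNIV (\<lambda>x. \<Prod>i\<in>S. f i x)"
  using assms
  by (induction S rule: infinite_finite_induct)
    (auto intro: Cinf_on_UNIV_const Cinf_on_UNIV_mult)

lemma Cinf_on_UNIV_continuous: "Cinf_on UNIV f \<Longrightarrow> continuous_on UNIV f"
  unfolding Cinf_on_def using Ck_on_UNIV_continuous[of 0 f] by simp

lemma Cinf_on_UNIV_derivative:
  assumes "Cinf_on UNIV f"
  shows "(f has_derivative frechet_derivative f (at x)) (at x)"
    and "Cinf_on UNIV (\<lambda>x. frechet_derivative f (at x) h)"
proof -
  have "Ck_on (Suc k) UNIV f" for k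
    using assms unfolding Cinf_on_def by (rule spec)
  note Ck = this
  show "(f has_derivative frechet_derivative f (at x)) (at x)"
    by (rule Ck_on_UNIV_SucD(1)[OF Ck])
  show "Cinf_on UNIV (\<lambda>x. frechet_derivative f (at x) h)"
    unfolding Cinf_on_def by (intro allI Ck_on_UNIV_SucD(2)[OF Ck])
qed

section \<open>Flat exponentials, the source of all cut-off functions\<close>

text \<open>For index 0 this is the classical smooth function that is flat at the origin. The powers
  of \<open>inverse x\<close> are included so that the linear span of the family is closed under
  differentiation, which turns smoothness into an induction over the whole family.\<close>

definition flat_exp :: "nat \<Rightarrow> real \<Rightarrow> real" where
  "flat_exp n x = (if 0 < x then exp (- inverse x) * inverse x ^ n else 0)"

text \<open>With \<open>y = inverse x\<close>, the single term of order \<open>n + 2\<close> of the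
  exponential series already gives a lower bound for \<open>exp y\<close>. The two extra orders
  become the square of \<open>x\<close>, one more than differentiability at 0 with derivative 0
  consumes.\<close>

lemma flat_exp_bound: "\<bar>flat_exp n x\<bar> \<le> fact (n + 2) * \<bar>x\<bar>\<^sup>2"
proof (cases "0 < x")
  case True
  define y where "y = inverse x"
  have y: "y > 0" using True by (simp add: y_def)
  have "y ^ (n + 2) / fact (n + 2) \<le> exp y"
  proof -
    have "(\<Sum>k\<in>{n+2}. y ^ k / fact k) \<le> (\<Sum>k. y ^ k / fact k)"
      using y summable_exp[of y]
      by (intro sum_le_suminf) (auto simp: field_simps)
    then show ?thesis by (simp add: exp_def divide_inverse mult.commute)
  qed
  then have "y ^ (n + 2) \<le> exp y * fact (n + 2)"
    by (subst (asm) divide_le_eq) (auto simp del: fact_Suc)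
  then have "y ^ n * y\<^sup>2 \<le> fact (n + 2) * exp y"
    unfolding power_add by (simp only: mult.commute)
  then have "y ^ n * exp (- y) \<le> fact (n + 2) / y\<^sup>2"
    using y by (simp add: field_simps exp_minus del: fact_Suc)
  then show ?thesis using True
    by (simp add: flat_exp_def y_def field_simps del: fact_Suc)
next
  case False
  then show ?thesis by (simp add: flat_exp_def)
qed

lemma flat_exp_has_derivative:
  "(flat_exp n has_real_derivative flat_exp (n + 2) x - real n * flat_exp (n + 1) x) (at x)"
proof -
  consider "x > 0" | "x < 0" | "x = 0" by linarith
  then show ?thesis
  proof cases
    case 1
    have "((\<lambda>x. exp (- inverse x) * inverse x ^ n) has_real_derivative
        flat_exp (n + 2) x - real n * flat_exp (n + 1) x) (at x)"
    proof (cases n)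
      case 0
      then show ?thesis using 1
        by (auto intro!: derivative_eq_intros simp: flat_exp_def power2_eq_square)
    next
      case (Suc m)
      have "((\<lambda>x. exp (- inverse x) * inverse x ^ n) has_real_derivative
          exp (- inverse x) * (inverse x)\<^sup>2 * inverse x ^ n +
          (real n * inverse x ^ m * - (inverse x)\<^sup>2) * exp (- inverse x)) (at x)"
        unfolding Suc using 1
        by (auto intro!: derivative_eq_intros DERIV_power_Suc simp del: power_Suc simp: power2_eq_square algebra_simps)
      then show ?thesis using 1 Suc
        by (simp add: flat_exp_def power2_eq_square algebra_simps)
    qed
    then show ?thesis
      by (rule has_field_derivative_transform_within_open[where S = "{0<..}"])
        (use 1 in \<open>auto simp: flat_exp_def\<close>)
  next
    case 2
    have "((\<lambda>x. 0) has_real_derivative flat_exp (n + 2) x - real n * flat_exp (n + 1) x) (at x)"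
      using 2 by (auto simp: flat_exp_def)
    then show ?thesis
      by (rule has_field_derivative_transform_within_open[where S = "{..<0}"])
        (use 2 in \<open>auto simp: flat_exp_def\<close>)
  next
    case 3
    \<comment> \<open>At the origin the quadratic bound makes the difference quotient at most a
      constant times \<open>\<bar>h\<bar>\<close>.\<close>
    have "((\<lambda>h. flat_exp n h / h) \<longlongrightarrow> 0) (at 0)"
    proof (rule Lim_null_comparison)
      show "\<forall>\<^sub>F h in at 0. norm (flat_exp n h / h) \<le> fact (n + 2) * \<bar>h\<bar>"
      proof (rule always_eventually, rule allI)
        fix h :: real
        have "\<bar>flat_exp n h\<bar> \<le> (fact (n + 2) * \<bar>h\<bar>) * \<bar>h\<bar>"
          using flat_exp_bound[of n h] by (simp only: power2_eq_square mult.assoc)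
        then show "norm (flat_exp n h / h) \<le> fact (n + 2) * \<bar>h\<bar>"
          by (cases "h = 0") (simp_all add: pos_divide_le_eq del: fact_Suc)
      qed
      show "((\<lambda>h::real. fact (n + 2) * \<bar>h\<bar>) \<longlongrightarrow> 0) (at 0)"
        using tendsto_mult_left[OF tendsto_rabs[OF tendsto_ident_at], of "fact (n + 2)" 0 UNIV]
        by (simp del: fact_Suc)
    qed
    then show ?thesis
      unfolding 3 DERIV_def by (simp add: flat_exp_def[of _ 0])
  qed
qed

lemma Cinf_on_flat_exp: "Cinf_on UNIV (flat_exp n)"
proof -
  have "Ck_on k UNIV (flat_exp n)" for k
  proof (induction k arbitrary: n)
    case 0
    show ?case using DERIV_isCont[OF flat_exp_has_derivative]
      by (simp add: continuous_at_imp_continuous_on)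
  next
    case (Suc k)
    show ?case
    proof (rule Ck_on_UNIV_SucI)
      show "(flat_exp n has_derivative (*) (flat_exp (n + 2) x - real n * flat_exp (n + 1) x)) (at x)" for x
        using flat_exp_has_derivative by (simp add: has_field_derivative_def)
      have "Ck_on k UNIV (\<lambda>x. h * (flat_exp (n + 2) x + (- real n) * flat_exp (n + 1) x))" for h
        by (intro Ck_on_UNIV_bounded_linear_compose[OF bounded_linear_mult_right] Ck_on_UNIV_add Suc)
      then show "Ck_on k UNIV (\<lambda>x. (flat_exp (n + 2) x - real n * flat_exp (n + 1) x) * h)" for h
        by (simp add: mult.commute)
    qed
  qed
  then show ?thesis by (simp add: Cinf_on_def)
qed

lemma flat_exp_nonneg: "0 \<le> flat_exp n x"
  by (simp add: flat_exp_def)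

lemma flat_exp_eq_0_iff: "flat_exp n x = 0 \<longleftrightarrow> x \<le> 0"
  by (auto simp: flat_exp_def)

subsection \<open>Test functions and the fundamental lemma of the calculus of variations\<close>

definition box_bump :: "'a::euclidean_space \<Rightarrow> 'a \<Rightarrow> 'a \<Rightarrow> real" where
  "box_bump a b x = (\<Prod>i\<in>Basis. flat_exp 0 (x \<bullet> i - a \<bullet> i) * flat_exp 0 (b \<bullet> i - x \<bullet> i))"

lemma Cinf_on_box_bump: "Cinf_on UNIV (box_bump a b)"
  unfolding box_bump_def[abs_def]
  by (intro Cinf_on_UNIV_prod Cinf_on_UNIV_mult Cinf_on_UNIV_compose_real[OF Cinf_on_flat_exp]
      Cinf_on_UNIV_diff Cinf_on_UNIV_const Cinf_on_UNIV_bounded_linear bounded_linear_inner_left)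

lemma box_bump_nonneg: "0 \<le> box_bump a b x"
  unfolding box_bump_def by (intro prod_nonneg mult_nonneg_nonneg flat_exp_nonneg ballI)

lemma box_bump_eq_0_iff: "box_bump a b x = 0 \<longleftrightarrow> x \<notin> box a b"
  unfolding box_bump_def prod_zero_iff[OF finite_Basis] mult_eq_0_iff flat_exp_eq_0_iff mem_box
  by (force simp: not_less)

lemma Cinf0I:
  assumes "Cinf_on UNIV f" and "\<And>x. f x \<noteq> 0 \<Longrightarrow> x \<in> K" and "compact K" "K \<subseteq> S"
  shows "f \<in> Cinf0 S"
proof -
  have sub: "closure {x. f x \<noteq> 0} \<subseteq> K"
    using assms(2) compact_imp_closed[OF assms(3)] by (intro closure_minimal) auto
  then have "bounded (closure {x. f x \<noteq> 0})"
    using compact_imp_bounded[OF assms(3)] bounded_subset by blast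
  then have "compact (closure {x. f x \<noteq> 0})"
    by (simp add: compact_eq_bounded_closed)
  then show ?thesis using assms sub by (auto simp: Cinf0_def)
qed

text \<open>Every open box is the limit of the saturated bumps \<open>n \<psi> / (1 + n \<psi>)\<close>, and boxes form an
  intersection-stable generator of the Borel sets.\<close>

lemma AE_eq_0_if_orthogonal_to_test_functions:
  fixes h :: "'a::euclidean_space \<Rightarrow> real"
  assumes int: "set_integrable lebesgue (cbox a b) h"
    and orth: "\<And>\<psi>. \<psi> \<in> Cinf0 (cbox a b) \<Longrightarrow> (LINT x|lebesgue. h x * \<psi> x) = 0"
  shows "AE x in lebesgue. x \<in> box a b \<longrightarrow> h x = 0"
proof -
  \<comment> \<open>Cutting off outside the closed box turns local integrability into integrability
    on the whole space, as dominated convergence requires; test functions supported in the box do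
    not notice the change.\<close>
  define K where "K x = indicator (cbox a b) x * h x" for x
  have K: "integrable lebesgue K"
    using int by (simp add: set_integrable_def K_def[abs_def])
  have box0: "(LINT x|lebesgue. K x * indicator (box c d) x) = 0"
    if "cbox c d \<subseteq> cbox a b" for c d
  proof -
    define s where "s n x = (real n * box_bump c d x) * inverse (1 + real n * box_bump c d x)" for n x
    have pos: "1 + real n * box_bump c d x > 0" for n x
      using box_bump_nonneg[of c d x] by (simp add: add_pos_nonneg)
    have s_smooth: "Cinf_on UNIV (s n)" for n
      unfolding s_def using pos[THEN less_imp_neq, THEN not_sym]
      by (intro Cinf_on_UNIV_mult Cinf_on_UNIV_inverse Cinf_on_UNIV_add Cinf_on_UNIV_const
          Cinf_on_box_bump) auto
    have s_supp: "s n x = 0" if "x \<notin> box c d" for n x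
      using that box_bump_eq_0_iff[of c d x] by (simp add: s_def)
    have s_test: "s n \<in> Cinf0 (cbox a b)" for n
      using s_supp box_subset_cbox[of c d] that
      by (intro Cinf0I[OF s_smooth, of _ "cbox c d"]) auto
    have s_K: "(LINT x|lebesgue. K x * s n x) = 0" for n
    proof -
      have "(\<lambda>x. K x * s n x) = (\<lambda>x. h x * s n x)"
      proof
        show "K x * s n x = h x * s n x" for x
          using s_supp[of x n] box_subset_cbox[of c d] that
          by (cases "x \<in> cbox a b") (auto simp: K_def)
      qed
      then show ?thesis using orth[OF s_test[of n]] by (simp only:)
    qed
    have "(\<lambda>n. LINT x|lebesgue. K x * s n x) \<longlonglongrightarrow> (LINT x|lebesgue. K x * indicator (box c d) x)"
    proof (rule integral_dominated_convergence[where w = "\<lambda>x. norm (K x)"])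
      have [measurable]: "s n \<in> borel_measurable lebesgue" for n
        using borel_measurable_continuous_onI[OF Cinf_on_UNIV_continuous[OF s_smooth]]
        by (simp add: measurable_completion)
      have [measurable]: "K \<in> borel_measurable lebesgue" using K by auto
      have [measurable]: "box c d \<in> sets lebesgue" by simp
      show "(\<lambda>x. K x * indicator (box c d) x) \<in> borel_measurable lebesgue" by measurable
      show "(\<lambda>x. K x * s n x) \<in> borel_measurable lebesgue" for n by measurable
      show "integrable lebesgue (\<lambda>x. norm (K x))" using K by simp
      show "AE x in lebesgue. (\<lambda>n. K x * s n x) \<longlonglongrightarrow> K x * indicator (box c d) x"
      proof (rule AE_I2, rule tendsto_mult_left)
        fix x
        show "(\<lambda>n. s n x) \<longlonglongrightarrow> indicator (box c d) x"
        proof (cases "x \<in> box c d")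
          case True
          then have "box_bump c d x > 0"
            using box_bump_eq_0_iff[of c d x] box_bump_nonneg[of c d x] by auto
          then have "(\<lambda>n. s n x) \<longlonglongrightarrow> 1" unfolding s_def by real_asymp
          then show ?thesis using True by simp
        qed (simp add: s_supp)
      qed
      have "\<bar>s n x\<bar> \<le> 1" for n x
      proof -
        have "real n * box_bump c d x \<ge> 0" by (simp add: box_bump_nonneg)
        then show ?thesis using pos[of n x]
          by (simp add: s_def field_simps)
      qed
      then show "AE x in lebesgue. norm (K x * s n x) \<le> norm (K x)" for n
        by (auto simp: abs_mult intro!: mult_right_le_one_le)
    qed
    then show ?thesis unfolding s_K using LIMSEQ_unique tendsto_const by blast
  qed
  \<comment> \<open>Only subboxes of the closed box can be tested, so the function is cut off to the
    open box, whose intersection with any open box is again an open box. The passage to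
    \<open>H'\<close> supplies a Borel function, because the generator argument runs over Borel sets
    while \<open>h\<close> is only Lebesgue measurable.\<close>
  define H where "H x = K x * indicator (box a b) x" for x
  have H: "integrable lebesgue H"
    using integrable_mult_indicator[OF _ K, of "box a b"] by (simp add: H_def[abs_def] mult.commute)
  then obtain H' where H': "H' \<in> borel_measurable lborel" "AE x in lborel. H x = H' x"
    using completion_ex_borel_measurable_real[of H lborel] by auto
  have ae: "AE x in lebesgue. H x = H' x" using H'(2) by (rule AE_completion)
  have H'leb: "H' \<in> borel_measurable lebesgue" using H'(1) by (rule measurable_completion)
  have intH': "integrable lborel H'"
    using integrable_cong_AE_imp[OF H H'leb] ae H'(1)
    by (simp add: integrable_completion eq_commute)
  have cut: "(LINT x|lborel. indicator B x *\<^sub>R H' x) = (LINT x|lebesgue. K x * indicator (box a b \<inter> B) x)"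
    if "B \<in> sets borel" for B
  proof -
    have [measurable]: "B \<in> sets lebesgue" "B \<in> sets lborel" using that by auto
    note [measurable] = H'(1) H'leb borel_measurable_integrable[OF H]
    have "(LINT x|lborel. indicator B x *\<^sub>R H' x) = (LINT x|lebesgue. indicator B x *\<^sub>R H' x)"
      by (rule integral_completion[symmetric]) measurable
    also have "\<dots> = (LINT x|lebesgue. indicator B x *\<^sub>R H x)"
      by (rule integral_cong_AE, measurable, measurable) (use ae in auto)
    also have "\<dots> = (LINT x|lebesgue. K x * indicator (box a b \<inter> B) x)"
      by (rule Bochner_Integration.integral_cong) (auto simp: H_def indicator_def)
    finally show ?thesis .
  qed
  \<comment> \<open>The complement step of the induction over the generated sigma algebra needs the
    integral over the whole space to vanish.\<close>
  have total: "(LINT x|lborel. H' x) = 0"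
    using cut[of UNIV] box0[of a b] by simp
  have "set_lebesgue_integral lborel B H' = 0" if "B \<in> sets lborel" for B
  proof -
    let ?G = "range (\<lambda>(a, b). box a b :: 'a set)"
    have box_G: "box p q \<in> ?G" for p q :: 'a
      using rangeI[of "\<lambda>(a, b). box a b" "(p, q)"] by simp
    have "Int_stable ?G"
      by (rule Int_stableI) (auto simp: box_Int_box box_G)
    moreover have "?G \<subseteq> Pow UNIV" by simp
    moreover have sig: "sigma_sets UNIV ?G = sets borel"
      by (subst borel_eq_box) (simp add: sets_measure_of)
    then have "B \<in> sigma_sets UNIV ?G" using that by simp
    ultimately show ?thesis
    proof (induction rule: sigma_sets_induct_disjoint)
      case (basic B)
      then obtain c d where B: "B = box c d" by auto
      define c' d' where "c' = (\<Sum>i\<in>Basis. max (a\<bullet>i) (c\<bullet>i) *\<^sub>R i)"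
        and "d' = (\<Sum>i\<in>Basis. min (b\<bullet>i) (d\<bullet>i) *\<^sub>R i)"
      have "box a b \<inter> B = box c' d'" unfolding B c'_def d'_def by (rule box_Int_box)
      moreover have "cbox c' d' \<subseteq> cbox a b" unfolding c'_def d'_def Int_interval[symmetric] by auto
      ultimately show ?case
        using cut[of B] box0[of c' d'] B by (simp add: set_lebesgue_integral_def)
    next
      case empty
      then show ?case by (simp add: set_lebesgue_integral_def)
    next
      case (compl B)
      then have B: "B \<in> sets lborel" using sig by simp
      have i: "integrable lborel (\<lambda>x. indicator B x *\<^sub>R H' x)"
        using integrable_mult_indicator[OF B intH'] .
      have "(LINT x|lborel. indicator (UNIV - B) x *\<^sub>R H' x) =
          (LINT x|lborel. H' x - indicator B x *\<^sub>R H' x)"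
        by (rule Bochner_Integration.integral_cong) (auto simp: indicator_def)
      also have "\<dots> = 0"
        using Bochner_Integration.integral_diff[OF intH' i] total compl.IH
        by (simp add: set_lebesgue_integral_def)
      finally show ?case by (simp add: set_lebesgue_integral_def)
    next
      case (union F)
      have F: "F i \<in> sets lborel" for i using union.hyps(2) sig by auto
      have "set_integrable lborel (\<Union>i. F i) H'"
        unfolding set_integrable_def using F by (intro integrable_mult_indicator intH') auto
      then have "set_lebesgue_integral lborel (\<Union>i. F i) H' = (\<Sum>i. set_lebesgue_integral lborel (F i) H')"
        using union.hyps(1) F by (intro lebesgue_integral_countable_add) (auto simp: disjoint_family_on_def)
      then show ?case using union.IH by simp
    qed
  qed
  then have "AE x in lborel. H' x = 0" by (rule sigma_finite_measure.density_zero[OF sigma_finite_lborel intH'])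
  then have "AE x in lborel. H x = 0" using H'(2) by eventually_elim simp
  then have "AE x in lebesgue. H x = 0" by (rule AE_completion)
  then show ?thesis
    by eventually_elim (use box_subset_cbox[of a b] in \<open>auto simp: H_def K_def indicator_def split: if_splits\<close>)
qed

section \<open>Translation invariance of the completed Lebesgue measure\<close>

lemma distr_lborel_plus: "distr lborel lborel ((+) (c::'a::euclidean_space)) = lborel"
  using lborel_distr_plus[of c] by (simp cong: distr_cong)

text \<open>Continuity gives measurability only for Borel sets. For the completion one also needs
  preimages of null sets to be null, which is translation invariance.\<close>

lemma measurable_plus_lebesgue: "(+) (c::'a::euclidean_space) \<in> lebesgue \<rightarrow>\<^sub>M lebesgue"
  by (rule completion.measurable_completion2)
    (simp_all add: distr_lborel_plus measurable_completion distr_completion)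

lemma distr_lebesgue_plus: "distr lebesgue lebesgue ((+) (c::'a::euclidean_space)) = lebesgue"
  using completion.completion_distr_eq[of "(+) c" lborel lborel]
  by (simp add: distr_lborel_plus measurable_completion distr_completion)

subsection \<open>Integration by parts and product measures\<close>

lemma set_integrable_scaleR_continuous:
  fixes W :: "'a::euclidean_space \<Rightarrow> real" and g :: "'a \<Rightarrow> 'b::euclidean_space"
  assumes "compact K" and W: "set_integrable lebesgue K W" and g: "continuous_on UNIV g"
  shows "set_integrable lebesgue K (\<lambda>x. W x *\<^sub>R g x)"
proof -
  obtain M where M: "\<And>x. x \<in> K \<Longrightarrow> norm (g x) \<le> M"
    using compact_continuous_image[OF continuous_on_subset[OF g subset_UNIV] \<open>compact K\<close>]
    by (metis compact_imp_bounded bounded_iff imageI)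
  have WK: "integrable lebesgue (\<lambda>x. indicator K x * W x)"
    using W by (simp add: set_integrable_def)
  have [measurable]: "g \<in> borel_measurable lebesgue"
    using borel_measurable_continuous_onI[OF g] by (simp add: measurable_completion)
  have "integrable lebesgue (\<lambda>x. (indicator K x * W x) *\<^sub>R g x)"
  proof (rule Bochner_Integration.integrable_bound)
    show "integrable lebesgue (\<lambda>x. M * (indicator K x * W x))"
      using WK by simp
    show "(\<lambda>x. (indicator K x * W x) *\<^sub>R g x) \<in> borel_measurable lebesgue"
      using borel_measurable_integrable[OF WK] by measurable
    have "norm ((indicator K x * W x) *\<^sub>R g x) \<le> norm (M * (indicator K x * W x))" for x
    proof (cases "x \<in> K")
      case True
      then have "\<bar>W x\<bar> * norm (g x) \<le> \<bar>W x\<bar> * \<bar>M\<bar>"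
        using M[of x] by (intro mult_left_mono) auto
      then show ?thesis using True
        by (simp add: abs_mult mult.commute)
    qed simp
    then show "AE x in lebesgue. norm ((indicator K x * W x) *\<^sub>R g x) \<le> norm (M * (indicator K x * W x))"
      by simp
  qed
  then show ?thesis by (simp add: set_integrable_def)
qed

lemma integrable_mult_compact_support:
  fixes W g :: "'a::euclidean_space \<Rightarrow> real"
  assumes "compact K" and W: "set_integrable lebesgue K W"
    and g: "continuous_on UNIV g" and supp: "\<And>x. g x \<noteq> 0 \<Longrightarrow> x \<in> K"
  shows "integrable lebesgue (\<lambda>x. W x * g x)"
proof -
  have "(\<lambda>x. indicator K x *\<^sub>R (W x *\<^sub>R g x)) = (\<lambda>x. W x * g x)"
    using supp by (auto simp: indicator_def fun_eq_iff)
  then show ?thesis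
    using set_integrable_scaleR_continuous[OF assms(1-3)] by (simp only: set_integrable_def)
qed

lemma frechet_derivative_eq_0_outside_closed:
  assumes "closed K" and "\<And>x. f x \<noteq> 0 \<Longrightarrow> x \<in> K" and "z \<notin> K"
  shows "frechet_derivative f (at z) = (\<lambda>_. 0)"
proof -
  have "((\<lambda>_. 0) has_derivative (\<lambda>_. 0)) (at z)" by simp
  then have "(f has_derivative (\<lambda>_. 0)) (at z)"
    by (rule has_derivative_transform_within_open[where s = "- K"]) (use assms in auto)
  then show ?thesis using frechet_derivative_at by metis
qed

text \<open>Integration by parts without Fubini: by translation invariance, every difference quotient
  of \<open>f\<close> in a direction along which \<open>W\<close> is constant integrates to zero against \<open>W\<close>.\<close>

lemma integral_invariant_weight_derivative:
  fixes W f :: "'a::euclidean_space \<Rightarrow> real"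
  assumes inv: "\<And>z s. W (z + s *\<^sub>R e) = W z"
    and W: "\<And>R. set_integrable lebesgue (cball 0 R) W"
    and f: "Cinf_on UNIV f" and "bounded {x. f x \<noteq> 0}"
  shows "(LINT z|lebesgue. W z * frechet_derivative f (at z) e) = 0"
proof -
  define D where "D z = frechet_derivative f (at z) e" for z
  obtain R where R: "\<And>x. f x \<noteq> 0 \<Longrightarrow> norm x \<le> R"
    using assms(4) by (auto simp: bounded_iff)
  \<comment> \<open>The increments \<open>h n\<close> never exceed 1, so the supports of all
    difference quotients stay in one ball of this radius.\<close>
  define R' where "R' = R + norm e"
  have f_cont: "continuous_on UNIV f" and D_cont: "continuous_on UNIV D"
    using Cinf_on_UNIV_continuous[OF f] Cinf_on_UNIV_continuous[OF Cinf_on_UNIV_derivative(2)[OF f]]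
    by (simp_all add: D_def[abs_def])
  have D0: "norm z \<le> R" if "D z \<noteq> 0" for z
  proof (rule ccontr)
    assume "\<not> norm z \<le> R"
    with frechet_derivative_eq_0_outside_closed[of "cball 0 R" f z] R that
    show False by (auto simp: D_def)
  qed
  obtain B where B: "\<And>z. \<bar>D z\<bar> \<le> B"
  proof -
    obtain M where "\<And>x. x \<in> cball 0 R \<Longrightarrow> norm (D x) \<le> M"
      using compact_continuous_image[OF continuous_on_subset[OF D_cont subset_UNIV] compact_cball]
      by (metis compact_imp_bounded bounded_iff imageI)
    then have "\<bar>D z\<bar> \<le> max M 0" for z
      using D0[of z] by (cases "D z = 0") (auto simp: le_max_iff_disj)
    then show ?thesis by (rule that)
  qed
  have line: "((\<lambda>s. f (z + s *\<^sub>R e)) has_derivative (\<lambda>k. k * D (z + s *\<^sub>R e))) (at s within T)" for z s T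
  proof -
    have "((\<lambda>s. z + s *\<^sub>R e) has_derivative (\<lambda>k. k *\<^sub>R e)) (at s within T)"
      by (auto intro!: derivative_eq_intros)
    from has_derivative_compose[OF this Cinf_on_UNIV_derivative(1)[OF f]]
    show ?thesis
      using linear_cmul[OF has_derivative_linear[OF Cinf_on_UNIV_derivative(1)[OF f]]]
      by (simp add: D_def)
  qed
  define h where "h n = inverse (real (Suc n))" for n
  have h: "0 < h n" "h n \<le> 1" for n by (auto simp: h_def field_simps)
  define s where "s n z = (f (z + h n *\<^sub>R e) - f z) / h n" for n z
  \<comment> \<open>The mean value theorem on the segment from \<open>z\<close> to
    \<open>z + h n *\<^sub>R e\<close> bounds all quotients by the supremum of the directional
    derivative; together with the common support this gives the dominating function.\<close>
  have s_bound: "\<bar>s n z\<bar> \<le> B" for n z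
  proof -
    obtain y where "f (z + h n *\<^sub>R e) - f (z + 0 *\<^sub>R e) = (h n - 0) * D (z + y *\<^sub>R e)"
      using mvt_very_simple[of 0 "h n", OF less_imp_le[OF h(1)] line[of z]] by blast
    then have "s n z = D (z + y *\<^sub>R e)" using h(1)[of n] by (simp add: s_def)
    then show ?thesis using B by simp
  qed
  have s_supp: "norm z \<le> R'" if "s n z \<noteq> 0" for n z
  proof -
    have "f (z + h n *\<^sub>R e) \<noteq> 0 \<or> f z \<noteq> 0" using that by (auto simp: s_def)
    then have "norm (z + h n *\<^sub>R e) \<le> R \<or> norm z \<le> R" using R by blast
    moreover have "norm (h n *\<^sub>R e) \<le> norm e"
      using h[of n] by (simp add: mult_left_le_one_le)
    moreover have "norm z - norm (h n *\<^sub>R e) \<le> norm (z + h n *\<^sub>R e)" "0 \<le> norm e"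
      by (rule norm_diff_ineq, rule norm_ge_zero)
    ultimately show ?thesis
      unfolding R'_def by linarith
  qed
  have s_cont: "continuous_on UNIV (s n)" for n
    unfolding s_def using h(1)[of n]
    by (intro continuous_intros continuous_on_compose2[OF f_cont]) auto
  have int0: "(LINT z|lebesgue. W z * s n z) = 0" for n
  proof -
    have Wf: "integrable lebesgue (\<lambda>z. W z * f z)"
      by (rule integrable_mult_compact_support[OF compact_cball W f_cont]) (use R in auto)
    have "integrable (distr lebesgue lebesgue ((+) (h n *\<^sub>R e))) (\<lambda>z. W z * f z)"
      using Wf by (simp add: distr_lebesgue_plus)
    note Wf' = integrable_distr[OF measurable_plus_lebesgue this]
    have inv': "W (h n *\<^sub>R e + z) = W z" for z
      using inv[of z "h n"] by (simp add: add.commute)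
    have "(LINT z|lebesgue. W z * f z) =
        (LINT z|distr lebesgue lebesgue ((+) (h n *\<^sub>R e)). W z * f z)"
      by (simp add: distr_lebesgue_plus)
    also have "\<dots> = (LINT z|lebesgue. W z * f (z + h n *\<^sub>R e))"
      using integral_distr[OF measurable_plus_lebesgue borel_measurable_integrable[OF Wf], of "h n *\<^sub>R e"]
      by (simp add: inv') (simp add: add.commute)
    finally have "(LINT z|lebesgue. W z * f (z + h n *\<^sub>R e) - W z * f z) = 0"
      using Wf Wf' by (simp add: inv') (simp add: add.commute)
    moreover have "W z * s n z = (W z * f (z + h n *\<^sub>R e) - W z * f z) / h n" for z
      by (simp add: s_def algebra_simps diff_divide_distrib)
    ultimately show ?thesis by simp
  qed
  have "(\<lambda>n. LINT z|lebesgue. W z * s n z) \<longlonglongrightarrow> (LINT z|lebesgue. W z * D z)"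
  proof (rule integral_dominated_convergence[where w = "\<lambda>z. B * \<bar>indicator (cball 0 R') z * W z\<bar>"])
    have "R \<le> R'" by (simp add: R'_def)
    then show "(\<lambda>z. W z * D z) \<in> borel_measurable lebesgue"
      by (intro borel_measurable_integrable integrable_mult_compact_support[OF compact_cball[of 0 R'] W D_cont])
        (use D0 in force)
    show "(\<lambda>z. W z * s n z) \<in> borel_measurable lebesgue" for n
      by (intro borel_measurable_integrable integrable_mult_compact_support[OF compact_cball[of 0 R'] W s_cont])
        (use s_supp in force)
    have "integrable lebesgue (\<lambda>z. indicator (cball 0 R') z * W z)"
      using W[of R'] by (simp add: set_integrable_def)
    then show "integrable lebesgue (\<lambda>z. B * \<bar>indicator (cball 0 R') z * W z\<bar>)"
      by (intro integrable_mult_right integrable_abs)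
    show "AE z in lebesgue. (\<lambda>n. W z * s n z) \<longlonglongrightarrow> W z * D z"
    proof (rule AE_I2, rule tendsto_mult_left)
      fix z
      have "((\<lambda>k. f (z + k *\<^sub>R e)) has_real_derivative D z) (at 0)"
        using line[of z 0 UNIV] by (simp add: has_field_derivative_def mult_commute_abs)
      then have lim: "((\<lambda>k. (f (z + k *\<^sub>R e) - f z) / k) \<longlongrightarrow> D z) (at 0)"
        by (simp add: DERIV_def)
      have "filterlim h (at 0) sequentially"
        unfolding filterlim_at h_def using LIMSEQ_inverse_real_of_nat by simp
      from filterlim_compose[OF lim this] show "(\<lambda>n. s n z) \<longlonglongrightarrow> D z"
        by (simp add: s_def)
    qed
    have "norm (W z * s n z) \<le> B * \<bar>indicator (cball 0 R') z * W z\<bar>" for n z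
    proof (cases "s n z = 0")
      case True
      then show ?thesis using B[of 0] by simp
    next
      case False
      then show ?thesis using s_supp[OF False] mult_left_mono[OF s_bound[of n z], of "\<bar>W z\<bar>"]
        by (simp add: abs_mult mult.commute)
    qed
    then show "AE z in lebesgue. norm (W z * s n z) \<le> B * \<bar>indicator (cball 0 R') z * W z\<bar>" for n
      by simp
  qed
  then show ?thesis unfolding int0 D_def using LIMSEQ_unique tendsto_const by blast
qed

section \<open>Null sets, projections and Tonelli on the completed product\<close>

text \<open>A cylinder over a null set has measure zero, even though its other side has infinite
  measure. Exceptional sets are enlarged to Borel null sets, because product formulas are available
  for \<open>lborel\<close> and not for its completion.\<close>

lemma AE_lborel_fst:
  assumes "AE t in lborel. P (t::'a::euclidean_space)"
  shows "AE z in lborel. P (fst (z::'a \<times> 'b::euclidean_space))"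
proof -
  obtain N where N: "N \<in> null_sets lborel" "{t. \<not> P t} \<subseteq> N"
    using assms by (auto simp: eventually_ae_filter)
  have "emeasure (lborel \<Otimes>\<^sub>M lborel) (N \<times> (UNIV :: 'b set)) = emeasure lborel N * emeasure lborel (UNIV :: 'b set)"
    using N by (intro lborel.emeasure_pair_measure_Times) auto
  then have "N \<times> (UNIV :: 'b set) \<in> null_sets lborel"
    using N unfolding null_sets_def lborel_prod
    by (auto simp: borel_prod[symmetric] intro: pair_measureI)
  then show ?thesis
    using N(2) by (intro AE_I'[of "N \<times> UNIV"]) auto
qed

lemma AE_lborel_snd:
  assumes "AE t in lborel. P (t::'b::euclidean_space)"
  shows "AE z in lborel. P (snd (z::'a::euclidean_space \<times> 'b))"
proof -
  obtain N where N: "N \<in> null_sets lborel" "{t. \<not> P t} \<subseteq> N"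
    using assms by (auto simp: eventually_ae_filter)
  have "emeasure (lborel \<Otimes>\<^sub>M lborel) ((UNIV :: 'a set) \<times> N) = emeasure lborel (UNIV :: 'a set) * emeasure lborel N"
    using N by (intro lborel.emeasure_pair_measure_Times) auto
  then have "(UNIV :: 'a set) \<times> N \<in> null_sets lborel"
    using N unfolding null_sets_def lborel_prod
    by (auto simp: borel_prod[symmetric] intro: pair_measureI)
  then show ?thesis
    using N(2) by (intro AE_I'[of "UNIV \<times> N"]) auto
qed

text \<open>A Lebesgue set is a Borel set up to a null set, and the preimage of a null set under the
  projection is a null cylinder.\<close>

lemma measurable_fst_lebesgue: "(fst :: 'a::euclidean_space \<times> 'b::euclidean_space \<Rightarrow> 'a) \<in> lebesgue \<rightarrow>\<^sub>M lebesgue"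
proof (rule completion.measurable_completion2)
  have m: "(fst :: 'a \<times> 'b \<Rightarrow> 'a) \<in> lborel \<rightarrow>\<^sub>M lborel"
    using borel_measurable_continuous_onI[OF continuous_on_fst[OF continuous_on_id]] by simp
  then show "(fst :: 'a \<times> 'b \<Rightarrow> 'a) \<in> lebesgue \<rightarrow>\<^sub>M lborel" by (rule measurable_completion)
  show "null_sets lborel \<subseteq> null_sets (distr lebesgue lborel (fst :: 'a \<times> 'b \<Rightarrow> 'a))"
  proof
    fix N :: "'a set" assume N: "N \<in> null_sets lborel"
    have "AE z in lborel. fst (z::'a \<times> 'b) \<notin> N"
      by (rule AE_lborel_fst[OF AE_not_in[OF N]])
    then have "AE t in distr lborel lborel (fst :: 'a \<times> 'b \<Rightarrow> 'a). t \<notin> N"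
      using N m by (subst AE_distr_iff) auto
    then have "N \<in> null_sets (distr lborel lborel (fst :: 'a \<times> 'b \<Rightarrow> 'a))"
      using N by (subst AE_iff_null_sets) auto
    then show "N \<in> null_sets (distr lebesgue lborel (fst :: 'a \<times> 'b \<Rightarrow> 'a))"
      by (simp add: distr_completion[OF m])
  qed
qed

lemma measurable_snd_lebesgue: "(snd :: 'a::euclidean_space \<times> 'b::euclidean_space \<Rightarrow> 'b) \<in> lebesgue \<rightarrow>\<^sub>M lebesgue"
proof (rule completion.measurable_completion2)
  have m: "(snd :: 'a \<times> 'b \<Rightarrow> 'b) \<in> lborel \<rightarrow>\<^sub>M lborel"
    using borel_measurable_continuous_onI[OF continuous_on_snd[OF continuous_on_id]] by simp
  then show "(snd :: 'a \<times> 'b \<Rightarrow> 'b) \<in> lebesgue \<rightarrow>\<^sub>M lborel" by (rule measurable_completion)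
  show "null_sets lborel \<subseteq> null_sets (distr lebesgue lborel (snd :: 'a \<times> 'b \<Rightarrow> 'b))"
  proof
    fix N :: "'b set" assume N: "N \<in> null_sets lborel"
    have "AE z in lborel. snd (z::'a \<times> 'b) \<notin> N"
      by (rule AE_lborel_snd[OF AE_not_in[OF N]])
    then have "AE t in distr lborel lborel (snd :: 'a \<times> 'b \<Rightarrow> 'b). t \<notin> N"
      using N m by (subst AE_distr_iff) auto
    then have "N \<in> null_sets (distr lborel lborel (snd :: 'a \<times> 'b \<Rightarrow> 'b))"
      using N by (subst AE_iff_null_sets) auto
    then show "N \<in> null_sets (distr lebesgue lborel (snd :: 'a \<times> 'b \<Rightarrow> 'b))"
      by (simp add: distr_completion[OF m])
  qed
qed

text \<open>Tonelli for products of merely Lebesgue measurable factors: each factor is replaced by a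
  Borel representative, and on the product the two sides differ only on null cylinders.\<close>

lemma nn_integral_lebesgue_tensor:
  fixes f :: "'a::euclidean_space \<Rightarrow> ennreal" and g :: "'b::euclidean_space \<Rightarrow> ennreal"
  assumes "f \<in> borel_measurable lebesgue" "g \<in> borel_measurable lebesgue"
  shows "(\<integral>\<^sup>+ z. f (fst z) * g (snd z) \<partial>lebesgue) = (\<integral>\<^sup>+ t. f t \<partial>lebesgue) * (\<integral>\<^sup>+ x. g x \<partial>lebesgue)"
proof -
  obtain f' g' where f': "f' \<in> borel_measurable lborel" "AE t in lborel. f t = f' t"
    and g': "g' \<in> borel_measurable lborel" "AE t in lborel. g t = g' t"
    using completion_ex_borel_measurable[OF assms(1)] completion_ex_borel_measurable[OF assms(2)] by blast
  have [measurable]: "f' \<in> borel_measurable borel" "g' \<in> borel_measurable borel"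
    using f' g' by auto
  have "(\<integral>\<^sup>+ z. f (fst z) * g (snd z) \<partial>lebesgue) = (\<integral>\<^sup>+ z. f' (fst z) * g' (snd z) \<partial>lborel)"
    unfolding nn_integral_completion
    by (rule nn_integral_cong_AE)
      (use AE_lborel_fst[OF f'(2), where 'b = 'b] AE_lborel_snd[OF g'(2), where 'a = 'a] in \<open>eventually_elim, simp\<close>)
  also have "\<dots> = (\<integral>\<^sup>+ t. \<integral>\<^sup>+ x. f' t * g' x \<partial>lborel \<partial>lborel)"
    by (subst lborel_prod[symmetric], subst lborel.nn_integral_fst[symmetric]) (simp_all)
  also have "\<dots> = (\<integral>\<^sup>+ t. f' t \<partial>lborel) * (\<integral>\<^sup>+ x. g' x \<partial>lborel)"
    by (simp add: nn_integral_cmult nn_integral_multc)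
  also have "\<dots> = (\<integral>\<^sup>+ t. f t \<partial>lebesgue) * (\<integral>\<^sup>+ x. g x \<partial>lebesgue)"
    unfolding nn_integral_completion using f'(2) g'(2)
    by (intro arg_cong2[where f = "(*)"] nn_integral_cong_AE) (auto simp: eq_commute)
  finally show ?thesis .
qed

subsection \<open>Distributional gradients\<close>

lemma frechet_derivative_support:
  assumes "closed K" "\<And>x. f x \<noteq> 0 \<Longrightarrow> x \<in> K" "frechet_derivative f (at z) h \<noteq> 0"
  shows "z \<in> K"
  using frechet_derivative_eq_0_outside_closed[of K f z] assms by metis

text \<open>The derivative of \<open>V z * \<psi> z\<close> integrates to zero against the weight,
  and the product rule splits it. No regularity of \<open>W\<close> is used beyond constancy along
  \<open>e\<close>. The weight 1 yields ordinary weak gradients; a weight depending on time alone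
  yields spatial gradients of tensor products.\<close>

lemma integral_by_parts_invariant_weight:
  fixes W V \<psi> :: "'a::euclidean_space \<Rightarrow> real"
  assumes inv: "\<And>z s. W (z + s *\<^sub>R e) = W z"
    and W: "\<And>R. set_integrable lebesgue (cball 0 R) W"
    and V: "Cinf_on UNIV V" and \<psi>: "Cinf_on UNIV \<psi>" "compact K" "\<And>x. \<psi> x \<noteq> 0 \<Longrightarrow> x \<in> K"
  shows "(LINT z|lebesgue. W z * V z * frechet_derivative \<psi> (at z) e) =
    - (LINT z|lebesgue. W z * frechet_derivative V (at z) e * \<psi> z)"
proof -
  obtain R where R: "\<And>x. x \<in> K \<Longrightarrow> norm x \<le> R"
    using compact_imp_bounded[OF \<psi>(2)] by (auto simp: bounded_iff)
  have supp: "norm x \<le> R" if "\<psi> x \<noteq> 0" for x using that \<psi>(3) R by blast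
  have supp': "norm x \<le> R" if "frechet_derivative \<psi> (at x) e \<noteq> 0" for x
    using frechet_derivative_support[of "cball 0 R" \<psi> x e] supp that by auto
  note cont = Cinf_on_UNIV_continuous[OF V] Cinf_on_UNIV_continuous[OF \<psi>(1)]
    Cinf_on_UNIV_continuous[OF Cinf_on_UNIV_derivative(2)[OF V]]
    Cinf_on_UNIV_continuous[OF Cinf_on_UNIV_derivative(2)[OF \<psi>(1)]]
  have i1: "integrable lebesgue (\<lambda>z. W z * (V z * frechet_derivative \<psi> (at z) e))"
    by (rule integrable_mult_compact_support[OF compact_cball[of 0 R] W])
      (use supp' in \<open>auto intro!: continuous_on_mult cont\<close>)
  have i2: "integrable lebesgue (\<lambda>z. W z * (frechet_derivative V (at z) e * \<psi> z))"
    by (rule integrable_mult_compact_support[OF compact_cball[of 0 R] W])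
      (use supp in \<open>auto intro!: continuous_on_mult cont\<close>)
  have "frechet_derivative (\<lambda>z. V z * \<psi> z) (at z) e =
      V z * frechet_derivative \<psi> (at z) e + frechet_derivative V (at z) e * \<psi> z" for z
    using frechet_derivative_at[OF has_derivative_mult[OF Cinf_on_UNIV_derivative(1)[OF V]
          Cinf_on_UNIV_derivative(1)[OF \<psi>(1)]], symmetric]
    by simp
  then have "(LINT z|lebesgue. W z * (V z * frechet_derivative \<psi> (at z) e) +
      W z * (frechet_derivative V (at z) e * \<psi> z)) =
    (LINT z|lebesgue. W z * frechet_derivative (\<lambda>z. V z * \<psi> z) (at z) e)"
    by (simp add: distrib_left)
  also have "\<dots> = 0"
  proof (rule integral_invariant_weight_derivative[OF inv W Cinf_on_UNIV_mult[OF V \<psi>(1)]])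
    show "bounded {x. V x * \<psi> x \<noteq> 0}"
      using supp by (auto simp: bounded_iff)
  qed
  finally show ?thesis
    using i1 i2 by (simp add: mult.assoc)
qed

lemma Cinf0_support:
  assumes "f \<in> Cinf0 S"
  obtains K where "compact K" "K \<subseteq> S" "\<And>x. f x \<noteq> 0 \<Longrightarrow> x \<in> K" "Cinf_on UNIV f"
  using assms closure_subset[of "{x. f x \<noteq> 0}"]
  by (intro that[of "closure {x. f x \<noteq> 0}"]) (auto simp: Cinf0_def simp del: compact_closure)

lemma integral_lebesgue_on_eq_lebesgue:
  fixes f :: "'a::euclidean_space \<Rightarrow> real"
  assumes "S \<in> sets lebesgue" "\<And>x. x \<notin> S \<Longrightarrow> f x = 0"
  shows "(LINT x|lebesgue_on S. f x) = (LINT x|lebesgue. f x)"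
proof -
  have eq: "(\<lambda>x. indicator S x *\<^sub>R f x) = f"
    using assms(2) by (auto simp: indicator_def fun_eq_iff)
  show ?thesis using integral_restrict_space[of S lebesgue f] assms(1) unfolding eq by simp
qed

lemma locally_integrable_on_bounded_linear:
  assumes "f locally_integrable_on S" "bounded_linear L"
  shows "(\<lambda>x. L (f x)) locally_integrable_on S"
  unfolding locally_integrable_on_def
proof (intro allI impI)
  fix K assume "compact K \<and> K \<subseteq> S"
  then have "integrable lebesgue (\<lambda>x. indicator K x *\<^sub>R f x)"
    using assms(1) by (auto simp: locally_integrable_on_def set_integrable_def)
  from integrable_bounded_linear[OF assms(2) this] show "(\<lambda>x. L (f x)) absolutely_integrable_on K"
    by (simp add: set_integrable_def linear_cmul[OF bounded_linear.linear[OF assms(2)]])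
qed

lemma locally_integrable_on_cong:
  "(\<And>x. x \<in> S \<Longrightarrow> f x = g x) \<Longrightarrow> f locally_integrable_on S \<longleftrightarrow> g locally_integrable_on S"
  unfolding locally_integrable_on_def
  by (metis (no_types, lifting) set_integrable_cong subsetD)

lemma integrable_locally_integrable_mult:
  fixes f g :: "'a::euclidean_space \<Rightarrow> real"
  assumes "f locally_integrable_on S" "continuous_on UNIV g" "compact K" "K \<subseteq> S"
    and "\<And>x. g x \<noteq> 0 \<Longrightarrow> x \<in> K"
  shows "integrable lebesgue (\<lambda>x. f x * g x)"
  using assms unfolding locally_integrable_on_def by (intro integrable_mult_compact_support) auto

lemma grad_nth:
  assumes "Cinf_on UNIV v"
  shows "grad v x $ i $ j = frechet_derivative (\<lambda>y. v y $ i) (at x) (axis j 1)"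
proof -
  have "((\<lambda>y. v y $ i) has_derivative (\<lambda>h. frechet_derivative v (at x) h $ i)) (at x)"
    by (rule bounded_linear.has_derivative[OF bounded_linear_vec_nth Cinf_on_UNIV_derivative(1)[OF assms]])
  from fun_cong[OF frechet_derivative_at[OF this], of "axis j 1"] show ?thesis
    by (simp add: grad_def jacobian_def matrix_def)
qed

lemma Cinf_on_nth: "Cinf_on UNIV v \<Longrightarrow> Cinf_on UNIV (\<lambda>y. v y $ i)"
  by (rule Cinf_on_UNIV_bounded_linear_compose[OF bounded_linear_vec_nth])

lemma continuous_on_grad:
  assumes "Cinf_on UNIV v"
  shows "continuous_on UNIV (grad v)"
proof -
  have "continuous_on UNIV (\<lambda>x. \<chi> i j. frechet_derivative (\<lambda>y. v y $ i) (at x) (axis j 1))"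
    by (intro continuous_on_vec_lambda Cinf_on_UNIV_continuous Cinf_on_UNIV_derivative(2) Cinf_on_nth assms)
  moreover have "grad v = (\<lambda>x. \<chi> i j. frechet_derivative (\<lambda>y. v y $ i) (at x) (axis j 1))"
    by (rule ext) (simp add: vec_eq_iff grad_nth[OF assms])
  ultimately show ?thesis by simp
qed

lemma grad_eq_0_outside_closed:
  assumes "closed K" and "\<And>x. v x \<noteq> 0 \<Longrightarrow> x \<in> K" and "z \<notin> K"
  shows "grad v z = 0"
  using frechet_derivative_eq_0_outside_closed[of K v z] assms
  by (simp add: grad_def jacobian_def matrix_def vec_eq_iff)

lemma set_integrable_lebesgue_const: "compact K \<Longrightarrow> set_integrable lebesgue K (\<lambda>_. 1::real)"
  by (simp add: absolutely_integrable_on_const lmeasurable_compact)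

lemma continuous_locally_integrable_on:
  fixes f :: "'a::euclidean_space \<Rightarrow> 'b::euclidean_space"
  assumes "continuous_on UNIV f"
  shows "f locally_integrable_on S"
  unfolding locally_integrable_on_def
  using set_integrable_scaleR_continuous[OF _ set_integrable_lebesgue_const assms] by auto

lemma weak_grad_smooth:
  fixes v :: "real^'d::finite \<Rightarrow> real^'d"
  assumes S: "open S" and v: "Cinf_on UNIV v"
  shows "weak_grad S v (grad v)"
  unfolding weak_grad_def
proof (intro conjI ballI allI)
  show "v locally_integrable_on S" "grad v locally_integrable_on S"
    by (intro continuous_locally_integrable_on Cinf_on_UNIV_continuous[OF v] continuous_on_grad[OF v])+
  fix \<psi> :: "real^'d \<Rightarrow> real" and i j assume "\<psi> \<in> Cinf0 S"
  then obtain K where K: "compact K" "K \<subseteq> S" "\<And>x. \<psi> x \<noteq> 0 \<Longrightarrow> x \<in> K" "Cinf_on UNIV \<psi>"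
    by (rule Cinf0_support) blast
  have S': "S \<in> sets lebesgue" using S by simp
  have \<psi>0: "\<psi> x = 0" "frechet_derivative \<psi> (at x) (axis j 1) = 0" if "x \<notin> S" for x
    using frechet_derivative_support[of K \<psi> x "axis j 1"] that K compact_imp_closed by blast+
  have "(LINT x|lebesgue_on S. v x $ i * partial j \<psi> x) =
      (LINT x|lebesgue. 1 * (v x $ i) * frechet_derivative \<psi> (at x) (axis j 1))"
    by (subst integral_lebesgue_on_eq_lebesgue[OF S']) (auto simp: \<psi>0 partial_def)
  also have "\<dots> = - (LINT x|lebesgue. 1 * frechet_derivative (\<lambda>y. v y $ i) (at x) (axis j 1) * \<psi> x)"
    by (rule integral_by_parts_invariant_weight[OF _ _ Cinf_on_nth[OF v] K(4,1,3)])
      (auto intro: set_integrable_lebesgue_const)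
  also have "\<dots> = - (LINT x|lebesgue_on S. grad v x $ i $ j * \<psi> x)"
    by (subst integral_lebesgue_on_eq_lebesgue[OF S']) (auto simp: \<psi>0 grad_nth[OF v])
  finally show "(LINT x|lebesgue_on S. v x $ i * partial j \<psi> x) =
      - (LINT x|lebesgue_on S. grad v x $ i $ j * \<psi> x)" .
qed

lemma bounded_linear_nth_nth: "bounded_linear (\<lambda>x::real^'a::finite^'b::finite. x $ i $ j)"
  by (rule bounded_linear_compose[OF bounded_linear_vec_nth bounded_linear_vec_nth])

lemma bounded_linear_sym_part: "bounded_linear (\<lambda>x::real^'a::finite^'a. (1/2) *\<^sub>R (x + transpose x))"
proof -
  have "linear (\<lambda>x::real^'a^'a. (1/2) *\<^sub>R (x + transpose x))"
    by (rule linearI) (auto simp: transpose_def vec_eq_iff algebra_simps add_divide_distrib)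
  then show ?thesis by (simp add: linear_linear)
qed

text \<open>Average of the defining identities for the index pairs \<open>(i, j)\<close> and
  \<open>(j, i)\<close>. The integrals may be split because \<open>v\<close> and \<open>g\<close>
  are locally integrable and the test function and its partial derivatives share a compact
  support.\<close>

lemma weak_sym_grad_if_weak_grad:
  fixes v :: "real^'d::finite \<Rightarrow> real^'d"
  assumes S: "open S" and g: "weak_grad S v g"
  shows "weak_sym_grad S v (\<lambda>x. (1/2) *\<^sub>R (g x + transpose (g x)))"
  unfolding weak_sym_grad_def
proof (intro conjI ballI allI)
  have li: "v locally_integrable_on S" "g locally_integrable_on S"
    using g by (auto simp: weak_grad_def)
  then show "v locally_integrable_on S"
    "(\<lambda>x. (1/2) *\<^sub>R (g x + transpose (g x))) locally_integrable_on S"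
    using locally_integrable_on_bounded_linear[OF _ bounded_linear_sym_part] by auto
  fix \<psi> :: "real^'d \<Rightarrow> real" and i j assume \<psi>: "\<psi> \<in> Cinf0 S"
  then obtain K where K: "compact K" "K \<subseteq> S" "\<And>x. \<psi> x \<noteq> 0 \<Longrightarrow> x \<in> K" "Cinf_on UNIV \<psi>"
    by (rule Cinf0_support) blast
  have S': "S \<in> sets lebesgue" using S by simp
  have supp: "x \<in> K" if "partial k \<psi> x \<noteq> 0" for k x
    using frechet_derivative_support[of K \<psi> x "axis k 1"] that K compact_imp_closed
    unfolding partial_def by blast
  have supp0: "partial k \<psi> x = 0" "\<psi> x = 0" if "x \<notin> K" for k x
    using that supp K(3) by blast+
  have cont: "continuous_on UNIV (partial k \<psi>)" "continuous_on UNIV \<psi>" for k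
    using Cinf_on_UNIV_continuous[OF Cinf_on_UNIV_derivative(2)[OF K(4)]] Cinf_on_UNIV_continuous[OF K(4)]
    by (auto simp: partial_def[abs_def])
  have to_lebesgue: "(LINT x|lebesgue_on S. F x) = (LINT x|lebesgue. F x)"
    if "\<And>x. x \<notin> K \<Longrightarrow> F x = 0" for F :: "real^'d \<Rightarrow> real"
    by (rule integral_lebesgue_on_eq_lebesgue[OF S']) (use that K in auto)
  have iv: "integrable lebesgue (\<lambda>x. v x $ k * partial l \<psi> x)" for k l
    by (rule integrable_locally_integrable_mult[OF locally_integrable_on_bounded_linear[OF li(1)] cont(1) K(1,2) supp])
      (auto intro: bounded_linear_vec_nth)
  have ig: "integrable lebesgue (\<lambda>x. g x $ k $ l * \<psi> x)" for k l
    by (rule integrable_locally_integrable_mult[OF locally_integrable_on_bounded_linear[OF li(2)] cont(2) K(1-3)])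
      (auto intro: bounded_linear_nth_nth)
  have eq: "(LINT x|lebesgue. v x $ k * partial l \<psi> x) = - (LINT x|lebesgue. g x $ k $ l * \<psi> x)" for k l
    using g \<psi> supp K(3) unfolding weak_grad_def by (subst (1 2) to_lebesgue[symmetric]) auto
  have "(LINT x|lebesgue. (1/2) * (v x $ i * partial j \<psi> x + v x $ j * partial i \<psi> x)) =
      - (LINT x|lebesgue. (1/2) * (g x $ i $ j * \<psi> x + g x $ j $ i * \<psi> x))"
    using iv ig eq by (simp add: field_simps)
  also have "(\<lambda>x. (1/2) * (g x $ i $ j * \<psi> x + g x $ j $ i * \<psi> x)) =
      (\<lambda>x. ((1/2) *\<^sub>R (g x + transpose (g x))) $ i $ j * \<psi> x)"
    by (auto simp: transpose_def algebra_simps)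
  finally show "(LINT x|lebesgue_on S. (1/2) * (v x $ i * partial j \<psi> x + v x $ j * partial i \<psi> x)) =
      - (LINT x|lebesgue_on S. ((1/2) *\<^sub>R (g x + transpose (g x))) $ i $ j * \<psi> x)"
    by (subst (1 2) to_lebesgue) (auto simp: supp0)
qed

text \<open>Turns a derivative taken slice by slice into a directional derivative on the product
  space, so that integration by parts along a purely spatial direction applies.\<close>

lemma st_partial_eq_frechet_derivative:
  assumes "Cinf_on UNIV \<psi>"
  shows "st_partial j \<psi> z = frechet_derivative \<psi> (at z) (0, axis j 1)"
proof -
  obtain t x where z: "z = (t, x)" by (cases z)
  have "((\<lambda>y. (t, y)) has_derivative (\<lambda>h. (0, h))) (at x)"
    by (auto intro!: derivative_eq_intros)
  from has_derivative_compose[OF this Cinf_on_UNIV_derivative(1)[OF assms]]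
  have "((\<lambda>y. \<psi> (t, y)) has_derivative (\<lambda>h. frechet_derivative \<psi> (at (t, x)) (0, h))) (at x)" .
  from fun_cong[OF frechet_derivative_at[OF this], of "axis j 1"] show ?thesis
    by (simp add: z st_partial_def partial_def)
qed

lemma st_weak_sym_grad_if_st_weak_grad:
  fixes v :: "real \<times> (real^'d::finite) \<Rightarrow> real^'d"
  assumes S: "open S" and g: "st_weak_grad S v g"
  shows "st_weak_sym_grad S v (\<lambda>z. (1/2) *\<^sub>R (g z + transpose (g z)))"
  unfolding st_weak_sym_grad_def
proof (intro conjI ballI allI)
  have li: "v locally_integrable_on S" "g locally_integrable_on S"
    using g by (auto simp: st_weak_grad_def)
  then show "v locally_integrable_on S"
    "(\<lambda>x. (1/2) *\<^sub>R (g x + transpose (g x))) locally_integrable_on S"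
    using locally_integrable_on_bounded_linear[OF _ bounded_linear_sym_part] by auto
  fix \<psi> :: "real \<times> (real^'d) \<Rightarrow> real" and i j assume \<psi>: "\<psi> \<in> Cinf0 S"
  then obtain K where K: "compact K" "K \<subseteq> S" "\<And>x. \<psi> x \<noteq> 0 \<Longrightarrow> x \<in> K" "Cinf_on UNIV \<psi>"
    by (rule Cinf0_support) blast
  have S': "S \<in> sets lebesgue" using S by simp
  have supp: "x \<in> K" if "st_partial k \<psi> x \<noteq> 0" for k x
    using frechet_derivative_support[of K \<psi> x "(0, axis k 1)"] that K compact_imp_closed
    unfolding st_partial_eq_frechet_derivative[OF K(4)] by blast
  have supp0: "st_partial k \<psi> x = 0" "\<psi> x = 0" if "x \<notin> K" for k x
    using that supp K(3) by blast+
  have cont: "continuous_on UNIV (st_partial k \<psi>)" "continuous_on UNIV \<psi>" for k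
    using Cinf_on_UNIV_continuous[OF Cinf_on_UNIV_derivative(2)[OF K(4)]] Cinf_on_UNIV_continuous[OF K(4)]
    by (auto simp: st_partial_eq_frechet_derivative[OF K(4), abs_def])
  have to_lebesgue: "(LINT x|lebesgue_on S. F x) = (LINT x|lebesgue. F x)"
    if "\<And>x. x \<notin> K \<Longrightarrow> F x = 0" for F :: "real \<times> (real^'d) \<Rightarrow> real"
    by (rule integral_lebesgue_on_eq_lebesgue[OF S']) (use that K in auto)
  have iv: "integrable lebesgue (\<lambda>x. v x $ k * st_partial l \<psi> x)" for k l
    by (rule integrable_locally_integrable_mult[OF locally_integrable_on_bounded_linear[OF li(1)] cont(1) K(1,2) supp])
      (auto intro: bounded_linear_vec_nth)
  have ig: "integrable lebesgue (\<lambda>x. g x $ k $ l * \<psi> x)" for k l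
    by (rule integrable_locally_integrable_mult[OF locally_integrable_on_bounded_linear[OF li(2)] cont(2) K(1-3)])
      (auto intro: bounded_linear_nth_nth)
  have eq: "(LINT x|lebesgue. v x $ k * st_partial l \<psi> x) = - (LINT x|lebesgue. g x $ k $ l * \<psi> x)" for k l
    using g \<psi> supp K(3) unfolding st_weak_grad_def by (subst (1 2) to_lebesgue[symmetric]) auto
  have "(LINT x|lebesgue. (1/2) * (v x $ i * st_partial j \<psi> x + v x $ j * st_partial i \<psi> x)) =
      - (LINT x|lebesgue. (1/2) * (g x $ i $ j * \<psi> x + g x $ j $ i * \<psi> x))"
    using iv ig eq by (simp add: field_simps)
  also have "(\<lambda>x. (1/2) * (g x $ i $ j * \<psi> x + g x $ j $ i * \<psi> x)) =
      (\<lambda>x. ((1/2) *\<^sub>R (g x + transpose (g x))) $ i $ j * \<psi> x)"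
    by (auto simp: transpose_def algebra_simps)
  finally show "(LINT x|lebesgue_on S. (1/2) * (v x $ i * st_partial j \<psi> x + v x $ j * st_partial i \<psi> x)) =
      - (LINT x|lebesgue_on S. ((1/2) *\<^sub>R (g x + transpose (g x))) $ i $ j * \<psi> x)"
    by (subst (1 2) to_lebesgue) (auto simp: supp0)
qed

text \<open>Each entry of the difference is orthogonal to all test functions in the box, so the
  fundamental lemma applies. The closed box has to lie in the domain because the gradients are only
  locally integrable there.\<close>

lemma st_weak_grad_unique:
  fixes v :: "real \<times> (real^'d::finite) \<Rightarrow> real^'d"
  assumes S: "open S" and g: "st_weak_grad S v g" and g': "st_weak_grad S v g'"
    and sub: "cbox a b \<subseteq> S"
  shows "AE z in lebesgue. z \<in> box a b \<longrightarrow> g z = g' z"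
proof -
  have S': "S \<in> sets lebesgue" using S by simp
  have li: "g locally_integrable_on S" "g' locally_integrable_on S"
    using g g' by (auto simp: st_weak_grad_def)
  have comp: "AE z in lebesgue. z \<in> box a b \<longrightarrow> g z $ i $ j - g' z $ i $ j = 0" for i j
  proof (rule AE_eq_0_if_orthogonal_to_test_functions)
    have "(\<lambda>z. g z $ i $ j) locally_integrable_on S" "(\<lambda>z. g' z $ i $ j) locally_integrable_on S"
      using li locally_integrable_on_bounded_linear[OF _ bounded_linear_nth_nth] by blast+
    note li' = this
    then show "set_integrable lebesgue (cbox a b) (\<lambda>z. g z $ i $ j - g' z $ i $ j)"
      using sub unfolding locally_integrable_on_def by (intro set_integral_diff) auto
    fix \<psi> :: "real \<times> (real^'d) \<Rightarrow> real" assume "\<psi> \<in> Cinf0 (cbox a b)"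
    then have \<psi>: "\<psi> \<in> Cinf0 S" using sub by (auto simp: Cinf0_def)
    then obtain K where K: "compact K" "K \<subseteq> S" "\<And>x. \<psi> x \<noteq> 0 \<Longrightarrow> x \<in> K" "Cinf_on UNIV \<psi>"
      by (rule Cinf0_support) blast
    have i: "integrable lebesgue (\<lambda>z. g z $ i $ j * \<psi> z)" "integrable lebesgue (\<lambda>z. g' z $ i $ j * \<psi> z)"
      using integrable_locally_integrable_mult[OF li'(1) Cinf_on_UNIV_continuous[OF K(4)] K(1-3)]
        integrable_locally_integrable_mult[OF li'(2) Cinf_on_UNIV_continuous[OF K(4)] K(1-3)] by auto
    have z: "\<psi> x = 0" if "x \<notin> S" for x using that K by blast
    have "(LINT z|lebesgue_on S. v z $ i * st_partial j \<psi> z) = - (LINT z|lebesgue_on S. g z $ i $ j * \<psi> z)"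
      "(LINT z|lebesgue_on S. v z $ i * st_partial j \<psi> z) = - (LINT z|lebesgue_on S. g' z $ i $ j * \<psi> z)"
      using g g' \<psi> unfolding st_weak_grad_def by blast+
    then have "(LINT z|lebesgue_on S. g z $ i $ j * \<psi> z) = (LINT z|lebesgue_on S. g' z $ i $ j * \<psi> z)"
      by linarith
    then have "(LINT z|lebesgue. g z $ i $ j * \<psi> z) = (LINT z|lebesgue. g' z $ i $ j * \<psi> z)"
      by (subst (asm) (1 2) integral_lebesgue_on_eq_lebesgue[OF S']) (auto simp: z)
    then show "(LINT z|lebesgue. (g z $ i $ j - g' z $ i $ j) * \<psi> z) = 0"
      using i by (simp add: left_diff_distrib)
  qed
  have "AE z in lebesgue. \<forall>i\<in>UNIV. \<forall>j\<in>UNIV. z \<in> box a b \<longrightarrow> g z $ i $ j - g' z $ i $ j = 0"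
    by (intro AE_finite_allI comp) auto
  then show ?thesis
    by eventually_elim (auto simp: vec_eq_iff)
qed

subsection \<open>Modulars and tensor products in space-time\<close>

lemma measurable_fst_lebesgue_on: "fst \<in> lebesgue_on (I \<times> S) \<rightarrow>\<^sub>M lebesgue_on I"
  by (rule measurable_restrict_space3[OF measurable_fst_lebesgue]) auto

lemma measurable_snd_lebesgue_on: "snd \<in> lebesgue_on (I \<times> S) \<rightarrow>\<^sub>M lebesgue_on S"
  by (rule measurable_restrict_space3[OF measurable_snd_lebesgue]) auto

lemma borel_measurable_tensor:
  fixes v :: "'a::euclidean_space \<Rightarrow> 'b::euclidean_space" and \<phi> :: "'c::euclidean_space \<Rightarrow> real"
  assumes "\<phi> \<in> borel_measurable (lebesgue_on I)" "v \<in> borel_measurable (lebesgue_on S)"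
  shows "(\<lambda>(t, x). \<phi> t *\<^sub>R v x) \<in> borel_measurable (lebesgue_on (I \<times> S))"
  using borel_measurable_scaleR[OF measurable_compose[OF measurable_fst_lebesgue_on assms(1)]
      measurable_compose[OF measurable_snd_lebesgue_on assms(2)]]
  by (simp add: case_prod_unfold)

lemma continuous_imp_borel_measurable_lebesgue_on:
  fixes f :: "'a::euclidean_space \<Rightarrow> 'b::euclidean_space"
  assumes "continuous_on UNIV f"
  shows "f \<in> borel_measurable (lebesgue_on S)"
  using borel_measurable_continuous_onI[OF assms]
  by (intro measurable_restrict_space1 measurable_completion) simp

text \<open>The ball lies in the product of the time axis with a ball in space, and over that
  product Tonelli bounds the integral by the integral of \<open>\<phi>\<close> over \<open>I\<close>
  times a finite volume. The indicator makes the profile a function on the whole axis.\<close>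

lemma set_integrable_weight_fst:
  fixes \<phi> :: "real \<Rightarrow> real"
  assumes "set_integrable lebesgue I \<phi>"
  shows "set_integrable lebesgue (cball 0 R) (\<lambda>z::real \<times> 'a::euclidean_space. indicator I (fst z) * \<phi> (fst z))"
proof -
  define W where "W t = indicator I t * \<phi> t" for t
  have W: "integrable lebesgue W" using assms by (simp add: set_integrable_def W_def[abs_def])
  note [measurable] = borel_measurable_integrable[OF W] measurable_fst_lebesgue measurable_snd_lebesgue
  have Wf: "(\<lambda>z::real \<times> 'a. W (fst z)) \<in> borel_measurable lebesgue" by measurable
  have "integrable lebesgue (\<lambda>z::real \<times> 'a. indicator (cball 0 R) z * W (fst z))"
  proof (rule integrableI_bounded)
    show "(\<lambda>z::real \<times> 'a. indicator (cball 0 R) z * W (fst z)) \<in> borel_measurable lebesgue"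
      using Wf by (intro borel_measurable_times borel_measurable_indicator) auto
    have "(\<integral>\<^sup>+ z. ennreal (norm (indicator (cball (0 :: real \<times> 'a) R) z * W (fst z))) \<partial>lebesgue) \<le>
        (\<integral>\<^sup>+ z. ennreal (norm (W (fst z))) * indicator (cball (0::'a) R) (snd z) \<partial>lebesgue)"
    proof (rule nn_integral_mono)
      fix z :: "real \<times> 'a"
      have "norm (snd z) \<le> norm z" by (metis norm_snd_le prod.collapse)
      then show "ennreal (norm (indicator (cball 0 R) z * W (fst z))) \<le>
          ennreal (norm (W (fst z))) * indicator (cball 0 R) (snd z)"
        by (auto simp: indicator_def)
    qed
    also have "\<dots> = (\<integral>\<^sup>+ t. ennreal (norm (W t)) \<partial>lebesgue) * (\<integral>\<^sup>+ x. indicator (cball (0::'a) R) x \<partial>lebesgue)"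
      by (rule nn_integral_lebesgue_tensor[where f = "\<lambda>t. ennreal (norm (W t))"])
        (auto intro!: borel_measurable_indicator)
    also have "\<dots> < \<infinity>"
      using W lmeasurable_cball[of "0::'a" R]
      by (auto simp: integrable_iff_bounded ennreal_mult_less_top fmeasurable_def)
    finally show "(\<integral>\<^sup>+ z. ennreal (norm (indicator (cball (0 :: real \<times> 'a) R) z * W (fst z))) \<partial>lebesgue) < \<infinity>" .
  qed
  then show ?thesis by (simp add: set_integrable_def W_def)
qed

text \<open>As a weight on space-time, the profile is constant in every spatial direction, so
  integration by parts falls on the smooth factor alone and integrability of \<open>\<phi>\<close>
  suffices.\<close>

lemma st_weak_grad_tensor:
  fixes v :: "real^'d::finite \<Rightarrow> real^'d" and \<phi> :: "real \<Rightarrow> real"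
  assumes \<phi>: "set_integrable lebesgue I \<phi>" and "open I" "open S" and v: "Cinf_on UNIV v"
  shows "st_weak_grad (I \<times> S) (\<lambda>(t, x). \<phi> t *\<^sub>R v x) (\<lambda>(t, x). \<phi> t *\<^sub>R grad v x)"
proof -
  let ?Q = "I \<times> S"
  define W where "W z = indicator I (fst z) * \<phi> (fst z)" for z :: "real \<times> (real^'d)"
  have Q: "?Q \<in> sets lebesgue" using assms(2,3) by (simp add: open_Times)
  have W: "set_integrable lebesgue (cball 0 R) W" for R
    unfolding W_def by (rule set_integrable_weight_fst[OF \<phi>])
  have WQ: "W (t, x) = \<phi> t" if "t \<in> I" for t x using that by (simp add: W_def)
  have li: "(\<lambda>(t, x). \<phi> t *\<^sub>R f x) locally_integrable_on ?Q" if "continuous_on UNIV f"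
    for f :: "real^'d \<Rightarrow> 'b::euclidean_space"
  proof -
    have "(\<lambda>z. W z *\<^sub>R f (snd z)) locally_integrable_on ?Q"
      unfolding locally_integrable_on_def
    proof (intro allI impI)
      fix K assume K: "compact K \<and> K \<subseteq> ?Q"
      then obtain R where "\<forall>z\<in>K. norm z \<le> R"
        using compact_imp_bounded[of K] unfolding bounded_iff by auto
      then have "K \<subseteq> cball 0 R" by auto
      with K have "set_integrable lebesgue K W"
        by (intro set_integrable_subset[OF W]) (auto intro: lmeasurable_compact fmeasurableD)
      then show "(\<lambda>z. W z *\<^sub>R f (snd z)) absolutely_integrable_on K"
        using K by (intro set_integrable_scaleR_continuous continuous_on_compose2[OF that] continuous_intros) auto
    qed
    then show ?thesis
      by (rule locally_integrable_on_cong[THEN iffD1, rotated]) (auto simp: WQ)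
  qed
  show ?thesis unfolding st_weak_grad_def
  proof (intro conjI ballI allI)
    show "(\<lambda>(t, x). \<phi> t *\<^sub>R v x) locally_integrable_on ?Q"
      "(\<lambda>(t, x). \<phi> t *\<^sub>R grad v x) locally_integrable_on ?Q"
      by (intro li Cinf_on_UNIV_continuous[OF v] continuous_on_grad[OF v])+
    fix \<psi> :: "real \<times> (real^'d) \<Rightarrow> real" and i j assume "\<psi> \<in> Cinf0 ?Q"
    then obtain K where K: "compact K" "K \<subseteq> ?Q" "\<And>x. \<psi> x \<noteq> 0 \<Longrightarrow> x \<in> K" "Cinf_on UNIV \<psi>"
      by (rule Cinf0_support) blast
    let ?e = "(0, axis j 1) :: real \<times> (real^'d)"
    define V where "V z = v (snd z) $ i" for z :: "real \<times> (real^'d)"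
    have V: "Cinf_on UNIV V" unfolding V_def
      by (rule Cinf_on_UNIV_compose_bounded_linear[OF bounded_linear_snd Cinf_on_nth[OF v]])
    have DV: "frechet_derivative V (at z) ?e = grad v (snd z) $ i $ j" for z
    proof -
      have "(V has_derivative (\<lambda>h. frechet_derivative (\<lambda>y. v y $ i) (at (snd z)) (snd h))) (at z)"
        unfolding V_def
        by (rule has_derivative_compose[OF _ Cinf_on_UNIV_derivative(1)[OF Cinf_on_nth[OF v]]])
          (auto intro!: derivative_eq_intros)
      from fun_cong[OF frechet_derivative_at[OF this], of ?e] show ?thesis
        by (simp add: grad_nth[OF v])
    qed
    have \<psi>0: "\<psi> z = 0" "frechet_derivative \<psi> (at z) ?e = 0" if "z \<notin> ?Q" for z
      using frechet_derivative_support[of K \<psi> z ?e] that K compact_imp_closed by blast+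
    have "(LINT z|lebesgue_on ?Q. (case z of (t, x) \<Rightarrow> \<phi> t *\<^sub>R v x) $ i * st_partial j \<psi> z) =
        (LINT z|lebesgue_on ?Q. W z * V z * frechet_derivative \<psi> (at z) ?e)"
      by (rule Bochner_Integration.integral_cong)
        (auto simp: W_def V_def st_partial_eq_frechet_derivative[OF K(4)])
    also have "\<dots> = (LINT z|lebesgue. W z * V z * frechet_derivative \<psi> (at z) ?e)"
      by (rule integral_lebesgue_on_eq_lebesgue[OF Q]) (use \<psi>0 in simp)
    also have "\<dots> = - (LINT z|lebesgue. W z * frechet_derivative V (at z) ?e * \<psi> z)"
      by (rule integral_by_parts_invariant_weight[OF _ W V K(4,1,3)]) (auto simp: W_def)
    also have "(LINT z|lebesgue. W z * frechet_derivative V (at z) ?e * \<psi> z) =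
        (LINT z|lebesgue_on ?Q. W z * frechet_derivative V (at z) ?e * \<psi> z)"
      by (rule integral_lebesgue_on_eq_lebesgue[OF Q, symmetric]) (use \<psi>0 in simp)
    also have "\<dots> = (LINT z|lebesgue_on ?Q. (case z of (t, x) \<Rightarrow> \<phi> t *\<^sub>R grad v x) $ i $ j * \<psi> z)"
      by (rule Bochner_Integration.integral_cong) (auto simp: W_def DV)
    finally show "(LINT z|lebesgue_on ?Q. (case z of (t, x) \<Rightarrow> \<phi> t *\<^sub>R v x) $ i * st_partial j \<psi> z) =
        - (LINT z|lebesgue_on ?Q. (case z of (t, x) \<Rightarrow> \<phi> t *\<^sub>R grad v x) $ i $ j * \<psi> z)" .
  qed
qed

section \<open>Modulars and Luxemburg norms\<close>

lemma modular_cong: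
  "(\<And>x. x \<in> S \<Longrightarrow> norm (f x) = norm (g x)) \<Longrightarrow> modular S p f = modular S p g"
  unfolding modular_def by (intro nn_integral_cong) auto

lemma lux_norm_cong:
  assumes "\<And>x. x \<in> S \<Longrightarrow> f x = g x"
  shows "lux_norm S p f = lux_norm S p g"
proof -
  have "modular S p (\<lambda>x. f x /\<^sub>R l) = modular S p (\<lambda>x. g x /\<^sub>R l)" for l
    by (rule modular_cong) (simp add: assms)
  then show ?thesis by (simp add: lux_norm_def)
qed

lemma Lvar_cong:
  "(\<And>x. x \<in> S \<Longrightarrow> f x = g x) \<Longrightarrow> f \<in> Lvar S p \<longleftrightarrow> g \<in> Lvar S p"
  unfolding Lvar_def
  using modular_cong[of S f g p] measurable_cong[of "lebesgue_on S" f g borel] by auto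

lemma lux_norm_0: "lux_norm S p (\<lambda>x. 0 :: 'b::real_normed_vector) = 0"
proof -
  have "modular S p (\<lambda>x. 0 :: 'b) = 0" by (simp add: modular_def)
  then have "lux_norm S p (\<lambda>x. 0 :: 'b) = Inf {0<..}"
    unfolding lux_norm_def by (intro arg_cong[where f = Inf]) (simp add: greaterThan_def)
  then show ?thesis by simp
qed

lemma modular_eq_lebesgue:
  assumes "S \<in> sets lebesgue"
  shows "modular S p f = (\<integral>\<^sup>+ x. ennreal (norm (f x) powr p x) * indicator S x \<partial>lebesgue)"
  unfolding modular_def using assms by (simp add: nn_integral_restrict_space)

lemma modular_le_bounded:
  assumes "S \<in> sets lebesgue" and "0 \<le> B"
    and "\<And>x. x \<in> S \<Longrightarrow> norm (f x) powr p x \<le> B"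
  shows "modular S p f \<le> ennreal B * emeasure lebesgue S"
proof -
  have "modular S p f \<le> (\<integral>\<^sup>+ x. ennreal B \<partial>lebesgue_on S)"
    unfolding modular_def using assms(3) by (intro nn_integral_mono) (auto intro: ennreal_leI)
  also have "\<dots> = ennreal B * emeasure lebesgue S"
    using assms(1) by (simp add: emeasure_restrict_space)
  finally show ?thesis .
qed

lemma bounded_in_Lvar:
  fixes f :: "'a::euclidean_space \<Rightarrow> 'b::euclidean_space"
  assumes S: "S \<in> lmeasurable" and f: "f \<in> borel_measurable (lebesgue_on S)"
    and bd: "\<And>x. x \<in> S \<Longrightarrow> norm (f x) \<le> M" and p: "\<And>x. x \<in> S \<Longrightarrow> 0 \<le> p x \<and> p x \<le> P"
  shows "f \<in> Lvar S p"
proof -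
  \<comment> \<open>Raising the base to at least 1 makes the power increasing in the exponent, so
    that \<open>P\<close> may replace \<open>p x\<close>.\<close>
  have "norm (f x) powr p x \<le> max M 1 powr P" if "x \<in> S" for x
  proof -
    have "norm (f x) powr p x \<le> max M 1 powr p x"
      using bd[OF that] p[OF that] by (intro powr_mono2) auto
    also have "\<dots> \<le> max M 1 powr P" using p[OF that] by (intro powr_mono) auto
    finally show ?thesis .
  qed
  then have "modular S p f \<le> ennreal (max M 1 powr P) * emeasure lebesgue S"
    using S by (intro modular_le_bounded) auto
  also have "\<dots> < \<infinity>" using S by (auto simp: ennreal_mult_less_top fmeasurable_def)
  finally show ?thesis using f by (simp add: Lvar_def)
qed

text \<open>The constancy of the exponent is required only where the space factor is nonzero:
  elsewhere the integrand is \<open>0 powr p x = 0\<close> for every exponent. This decouples time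
  from space, and lets the varying exponent be read as a single constant.\<close>

lemma modular_tensor:
  fixes v :: "'a::euclidean_space \<Rightarrow> 'b::euclidean_space" and \<phi> :: "real \<Rightarrow> real"
  assumes I: "I \<in> sets lebesgue" and S: "S \<in> sets lebesgue" and IS: "I \<times> S \<in> sets lebesgue"
    and \<phi>: "\<phi> \<in> borel_measurable (lebesgue_on I)" and v: "v \<in> borel_measurable (lebesgue_on S)"
    and c: "\<And>x. x \<in> S \<Longrightarrow> v x \<noteq> 0 \<Longrightarrow> p x = c"
  shows "modular (I \<times> S) (time_ext p) (\<lambda>(t, x). \<phi> t *\<^sub>R v x) =
    modular I (\<lambda>_. c) \<phi> * modular S (\<lambda>_. c) v"
proof -
  define f where "f t = ennreal (norm (\<phi> t) powr c) * indicator I t" for t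
  define g where "g x = ennreal (norm (v x) powr c) * indicator S x" for x
  have "(\<lambda>t. ennreal (norm (\<phi> t) powr c)) \<in> borel_measurable (lebesgue_on I)"
    using \<phi> by measurable
  then have f: "f \<in> borel_measurable lebesgue"
    using I unfolding f_def
    by (intro borel_measurable_restrict_space_iff_ennreal[THEN iffD1]) auto
  have "(\<lambda>t. ennreal (norm (v t) powr c)) \<in> borel_measurable (lebesgue_on S)"
    using v by measurable
  then have g: "g \<in> borel_measurable lebesgue"
    using S unfolding g_def
    by (intro borel_measurable_restrict_space_iff_ennreal[THEN iffD1]) auto
  have "modular (I \<times> S) (time_ext p) (\<lambda>(t, x). \<phi> t *\<^sub>R v x) =
      (\<integral>\<^sup>+ z. f (fst z) * g (snd z) \<partial>lebesgue)"
    unfolding modular_eq_lebesgue[OF IS]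
  proof (rule nn_integral_cong)
    fix z :: "real \<times> 'a"
    obtain t x where z: "z = (t, x)" by (cases z)
    show "ennreal (norm (case z of (t, x) \<Rightarrow> \<phi> t *\<^sub>R v x) powr time_ext p z) * indicator (I \<times> S) z =
        f (fst z) * g (snd z)"
      using c[of x]
      by (cases "v x = 0") (auto simp: z f_def g_def time_ext_def powr_mult ennreal_mult indicator_def)
  qed
  also have "\<dots> = (\<integral>\<^sup>+ t. f t \<partial>lebesgue) * (\<integral>\<^sup>+ x. g x \<partial>lebesgue)"
    by (rule nn_integral_lebesgue_tensor[OF f g])
  finally show ?thesis
    by (simp add: modular_eq_lebesgue[OF I] modular_eq_lebesgue[OF S] f_def g_def)
qed

lemma set_integrable_if_Lvar_2:
  fixes \<phi> :: "real \<Rightarrow> real"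
  assumes I: "I \<in> lmeasurable" and \<phi>: "\<phi> \<in> Lvar I (\<lambda>_. 2)"
  shows "set_integrable lebesgue I \<phi>"
proof -
  have m: "\<phi> \<in> borel_measurable (lebesgue_on I)" and fin: "modular I (\<lambda>_. 2) \<phi> < \<infinity>"
    using \<phi> by (auto simp: Lvar_def)
  have I': "I \<in> sets lebesgue" using I by auto
  have "integrable (lebesgue_on I) \<phi>"
  proof (rule integrableI_bounded[OF m])
    have "(\<integral>\<^sup>+ t. ennreal (norm (\<phi> t)) \<partial>lebesgue_on I) \<le>
        (\<integral>\<^sup>+ t. 1 + ennreal (norm (\<phi> t) powr 2) \<partial>lebesgue_on I)"
    proof (rule nn_integral_mono)
      fix t
      \<comment> \<open>The constant 1 is integrable because \<open>I\<close> has finite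
        measure.\<close>
      have "norm (\<phi> t) \<le> 1 + norm (\<phi> t) powr 2"
      proof (cases "\<phi> t = 0")
        case False
        have "0 \<le> (\<bar>\<phi> t\<bar> - 1)\<^sup>2" by simp
        then show ?thesis using False by (simp add: power2_eq_square algebra_simps) 
      qed simp
      then show "ennreal (norm (\<phi> t)) \<le> 1 + ennreal (norm (\<phi> t) powr 2)"
        by (metis ennreal_1 ennreal_leI ennreal_plus powr_ge_zero zero_le_one)
    qed
    also have "\<dots> = emeasure lebesgue I + modular I (\<lambda>_. 2) \<phi>"
      using m I' by (subst nn_integral_add) (auto simp: modular_def emeasure_restrict_space)
    also have "\<dots> < \<infinity>" using fin I by (auto simp: fmeasurable_def)
    finally show "(\<integral>\<^sup>+ t. ennreal (norm (\<phi> t)) \<partial>lebesgue_on I) < \<infinity>" .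
  qed
  then show ?thesis using I' by (simp add: set_integrable_def integrable_restrict_space)
qed

lemma bounded_if_compact_support:
  fixes f :: "'a::euclidean_space \<Rightarrow> 'b::euclidean_space"
  assumes "continuous_on UNIV f" "compact K" "\<And>x. f x \<noteq> 0 \<Longrightarrow> x \<in> K"
  obtains M where "\<And>x. norm (f x) \<le> M"
proof -
  obtain M where M: "\<And>x. x \<in> K \<Longrightarrow> norm (f x) \<le> M"
    using compact_continuous_image[OF continuous_on_subset[OF assms(1) subset_UNIV] assms(2)]
    by (metis compact_imp_bounded bounded_iff imageI)
  have "norm (f x) \<le> max M 0" for x
    using M[of x] assms(3)[of x] by (cases "f x = 0") auto
  then show ?thesis by (rule that)
qed

lemma sym_grad_eq_0_outside_closed:
  assumes "closed K" and "\<And>x. v x \<noteq> 0 \<Longrightarrow> x \<in> K" and "z \<notin> K"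
  shows "sym_grad v z = 0"
  using grad_eq_0_outside_closed[of K v z] assms by (simp add: sym_grad_def transpose_def vec_eq_iff)

lemma continuous_on_sym_grad:
  assumes "Cinf_on UNIV v"
  shows "continuous_on UNIV (sym_grad v)"
  unfolding sym_grad_def[abs_def]
  by (rule bounded_linear.continuous_on[OF bounded_linear_sym_part continuous_on_grad[OF assms]])

lemma Cinf0_grad_bounded:
  fixes v :: "real^'d::finite \<Rightarrow> real^'d"
  assumes "v \<in> Cinf0 S"
  obtains M where "\<And>x. norm (v x) \<le> M" "\<And>x. norm (grad v x) \<le> M" "\<And>x. norm (sym_grad v x) \<le> M"
proof -
  obtain K where K: "compact K" "K \<subseteq> S" "\<And>x. v x \<noteq> 0 \<Longrightarrow> x \<in> K" "Cinf_on UNIV v"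
    using assms by (rule Cinf0_support) blast
  have supp: "x \<in> K" if "grad v x \<noteq> 0" for x
    using grad_eq_0_outside_closed[of K v x] that K compact_imp_closed by blast
  have supp': "x \<in> K" if "sym_grad v x \<noteq> 0" for x
    using sym_grad_eq_0_outside_closed[of K v x] that K compact_imp_closed by blast
  obtain M1 M2 M3 where M: "\<And>x. norm (v x) \<le> M1" "\<And>x. norm (grad v x) \<le> M2"
    "\<And>x. norm (sym_grad v x) \<le> M3"
    using bounded_if_compact_support[OF Cinf_on_UNIV_continuous[OF K(4)] K(1,3)]
      bounded_if_compact_support[OF continuous_on_grad[OF K(4)] K(1) supp]
      bounded_if_compact_support[OF continuous_on_sym_grad[OF K(4)] K(1) supp'] by metis
  show ?thesis
    by (rule that[of "max M1 (max M2 M3)"]) (use M in \<open>auto simp: le_max_iff_disj\<close>)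
qed

text \<open>The field serves as its own approximation, with both error norms equal to zero.\<close>

lemma Cinf0_subset_X_sym:
  fixes v :: "real^'d::finite \<Rightarrow> real^'d"
  assumes S: "open S" "bounded S" and v: "v \<in> Cinf0 S"
    and p: "\<And>x. 0 \<le> p x \<and> p x \<le> P" and q: "\<And>x. 0 \<le> q x \<and> q x \<le> P"
  shows "v \<in> X_sym S q p"
proof -
  have smooth: "Cinf_on UNIV v" using v by (simp add: Cinf0_def)
  have S': "S \<in> lmeasurable" using S by (simp add: lmeasurable_open)
  obtain M where M: "\<And>x. norm (v x) \<le> M" "\<And>x. norm (sym_grad v x) \<le> M"
    using Cinf0_grad_bounded[OF v] by metis
  have "v \<in> Lvar S q"
    by (rule bounded_in_Lvar[OF S' continuous_imp_borel_measurable_lebesgue_on[OF Cinf_on_UNIV_continuous[OF smooth]] M(1) q])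
  moreover have "sym_grad v \<in> Lvar S p"
    by (rule bounded_in_Lvar[OF S' continuous_imp_borel_measurable_lebesgue_on[OF continuous_on_sym_grad[OF smooth]] M(2) p])
  moreover have "weak_sym_grad S v (sym_grad v)"
    using weak_sym_grad_if_weak_grad[OF S(1) weak_grad_smooth[OF S(1) smooth]]
    by (simp add: sym_grad_def[abs_def])
  moreover have "\<exists>\<psi>\<in>Cinf0 S. lux_norm S q (\<lambda>x. v x - \<psi> x) + lux_norm S p (\<lambda>x. sym_grad v x - sym_grad \<psi> x) < e"
    if "e > 0" for e
    using that v by (intro bexI[of _ v]) (simp_all add: lux_norm_0)
  ultimately show ?thesis unfolding X_sym_def by blast
qed

subsection \<open>Membership in the space-time spaces\<close>

text \<open>The field of the theorem is prescribed on the domain only, whereas members of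
  \<open>Cinf0\<close> are total functions vanishing outside it. This lemma and its companions carry
  membership from the zero extension to the given field.\<close>

lemma weak_sym_grad_cong:
  assumes "\<And>x. x \<in> S \<Longrightarrow> u x = v x" "weak_sym_grad S u g"
  shows "weak_sym_grad S v g"
proof -
  have "(LINT x|lebesgue_on S. (1/2) * (v x $ i * partial j \<psi> x + v x $ j * partial i \<psi> x)) =
      (LINT x|lebesgue_on S. (1/2) * (u x $ i * partial j \<psi> x + u x $ j * partial i \<psi> x))" for i j \<psi>
    by (rule Bochner_Integration.integral_cong) (auto simp: assms(1))
  then show ?thesis
    using assms(2) locally_integrable_on_cong[of S u v] assms(1) unfolding weak_sym_grad_def by auto
qed

lemma X_sym_cong:
  assumes eq: "\<And>x. x \<in> S \<Longrightarrow> u x = v x" and "u \<in> X_sym S q p"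
  shows "v \<in> X_sym S q p"
proof -
  have "lux_norm S q (\<lambda>x. v x - \<psi> x) = lux_norm S q (\<lambda>x. u x - \<psi> x)" for \<psi>
    by (rule lux_norm_cong) (simp add: eq)
  then show ?thesis
    using assms(2) Lvar_cong[of S u v q] eq weak_sym_grad_cong[of S u v] unfolding X_sym_def by auto
qed

lemma st_weak_sym_grad_cong:
  assumes "\<And>x. x \<in> S \<Longrightarrow> u x = v x" "st_weak_sym_grad S u g"
  shows "st_weak_sym_grad S v g"
proof -
  have "(LINT x|lebesgue_on S. (1/2) * (v x $ i * st_partial j \<psi> x + v x $ j * st_partial i \<psi> x)) =
      (LINT x|lebesgue_on S. (1/2) * (u x $ i * st_partial j \<psi> x + u x $ j * st_partial i \<psi> x))" for i j \<psi>
    by (rule Bochner_Integration.integral_cong) (auto simp: assms(1))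
  then show ?thesis
    using assms(2) locally_integrable_on_cong[of S u v] assms(1) unfolding st_weak_sym_grad_def by auto
qed

lemma st_weak_grad_cong:
  assumes "\<And>x. x \<in> S \<Longrightarrow> u x = v x" "st_weak_grad S u g"
  shows "st_weak_grad S v g"
proof -
  have "(LINT x|lebesgue_on S. v x $ i * st_partial j \<psi> x) =
      (LINT x|lebesgue_on S. u x $ i * st_partial j \<psi> x)" for i j \<psi>
    by (rule Bochner_Integration.integral_cong) (auto simp: assms(1))
  then show ?thesis
    using assms(2) locally_integrable_on_cong[of S u v] assms(1) unfolding st_weak_grad_def by auto
qed

lemma grad_sym_grad_scaleR:
  assumes "Cinf_on UNIV v"
  shows "grad (\<lambda>y. c *\<^sub>R v y) x = c *\<^sub>R grad v x"
    and "sym_grad (\<lambda>y. c *\<^sub>R v y) x = c *\<^sub>R sym_grad v x"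
proof -
  have "((\<lambda>y. c *\<^sub>R v y) has_derivative (\<lambda>h. c *\<^sub>R frechet_derivative v (at x) h)) (at x)"
    by (rule has_derivative_scaleR_right[OF Cinf_on_UNIV_derivative(1)[OF assms]])
  from frechet_derivative_at[OF this, symmetric]
  show *: "grad (\<lambda>y. c *\<^sub>R v y) x = c *\<^sub>R grad v x"
    by (simp add: grad_def jacobian_def matrix_def vec_eq_iff)
  show "sym_grad (\<lambda>y. c *\<^sub>R v y) x = c *\<^sub>R sym_grad v x"
    by (simp add: sym_grad_def * transpose_def vec_eq_iff algebra_simps)
qed

text \<open>The profile enters only through its quadratic modular: \<open>p\<close> is 2 wherever
  \<open>sym_grad v\<close> is nonzero, and the field itself is measured with exponent 2. In space
  there is nothing to approximate, since every slice is a multiple of the test function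
  \<open>v\<close>.\<close>

lemma tensor_in_calX_sym:
  fixes v :: "real^'d::finite \<Rightarrow> real^'d" and \<phi> :: "real \<Rightarrow> real"
  assumes I: "I = {0<..<T}" and S: "open S" "bounded S" and v: "v \<in> Cinf0 S"
    and p: "\<And>x. 0 \<le> p x \<and> p x \<le> 3" and sym0: "\<And>x. sym_grad v x \<noteq> 0 \<Longrightarrow> p x = 2"
    and \<phi>: "\<phi> \<in> Lvar I (\<lambda>_. 2)" and u: "\<And>x. x \<in> S \<Longrightarrow> u x = v x"
  shows "(\<lambda>(t, x). \<phi> t *\<^sub>R u x) \<in> calX_sym I S (\<lambda>_. 2) (time_ext p)"
proof -
  have smooth: "Cinf_on UNIV v" using v by (simp add: Cinf0_def)
  have Im: "I \<in> lmeasurable" "open I" using I by auto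
  have Sm: "S \<in> lmeasurable" using S by (simp add: lmeasurable_open)
  have sets: "I \<in> sets lebesgue" "S \<in> sets lebesgue" "I \<times> S \<in> sets lebesgue" "open (I \<times> S)"
    using Im Sm S(1) by (auto simp: open_Times)
  have \<phi>m: "\<phi> \<in> borel_measurable (lebesgue_on I)" and \<phi>fin: "modular I (\<lambda>_. 2) \<phi> < \<infinity>"
    using \<phi> by (auto simp: Lvar_def)
  have \<phi>i: "set_integrable lebesgue I \<phi>" by (rule set_integrable_if_Lvar_2[OF Im(1) \<phi>])
  obtain M where M: "\<And>x. norm (v x) \<le> M" "\<And>x. norm (sym_grad v x) \<le> M"
    using Cinf0_grad_bounded[OF v] by metis
  have vL: "v \<in> Lvar S (\<lambda>_. 2)" "sym_grad v \<in> Lvar S (\<lambda>_. 2)"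
    by (rule bounded_in_Lvar[OF Sm continuous_imp_borel_measurable_lebesgue_on[OF Cinf_on_UNIV_continuous[OF smooth]] M(1), where P = 2], simp)
      (rule bounded_in_Lvar[OF Sm continuous_imp_borel_measurable_lebesgue_on[OF continuous_on_sym_grad[OF smooth]] M(2), where P = 2], simp)
  have eq: "(case z of (t, x) \<Rightarrow> \<phi> t *\<^sub>R v x) = (case z of (t, x) \<Rightarrow> \<phi> t *\<^sub>R u x)" if "z \<in> I \<times> S" for z
    using that u by auto
  have "(\<lambda>(t, x). \<phi> t *\<^sub>R v x) \<in> Lvar (I \<times> S) (time_ext (\<lambda>_. 2))"
    unfolding Lvar_def using vL(1) \<phi>fin
    by (auto intro!: borel_measurable_tensor[OF \<phi>m] simp: Lvar_def ennreal_mult_less_top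
        modular_tensor[OF sets(1-3) \<phi>m, of _ _ 2])
  then have 1: "(\<lambda>(t, x). \<phi> t *\<^sub>R u x) \<in> Lvar (I \<times> S) (\<lambda>_. 2)"
    using Lvar_cong[of "I \<times> S", OF eq] by (simp add: time_ext_def case_prod_unfold)
  have "(\<lambda>(t, x). \<phi> t *\<^sub>R sym_grad v x) \<in> Lvar (I \<times> S) (time_ext p)"
    unfolding Lvar_def using vL(2) \<phi>fin
    by (auto intro!: borel_measurable_tensor[OF \<phi>m] simp: Lvar_def ennreal_mult_less_top sym0
        modular_tensor[OF sets(1-3) \<phi>m, of _ _ 2])
  moreover have "st_weak_sym_grad (I \<times> S) (\<lambda>(t, x). \<phi> t *\<^sub>R u x) (\<lambda>(t, x). \<phi> t *\<^sub>R sym_grad v x)"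
  proof -
    have "(\<lambda>z. (1/2) *\<^sub>R ((case z of (t, x) \<Rightarrow> \<phi> t *\<^sub>R grad v x) + transpose (case z of (t, x) \<Rightarrow> \<phi> t *\<^sub>R grad v x))) =
        (\<lambda>(t, x). \<phi> t *\<^sub>R sym_grad v x)"
      by (auto simp: fun_eq_iff sym_grad_def transpose_def vec_eq_iff algebra_simps)
    with st_weak_sym_grad_if_st_weak_grad[OF sets(4) st_weak_grad_tensor[OF \<phi>i Im(2) S(1) smooth]]
    have "st_weak_sym_grad (I \<times> S) (\<lambda>(t, x). \<phi> t *\<^sub>R v x) (\<lambda>(t, x). \<phi> t *\<^sub>R sym_grad v x)" by simp
    then show ?thesis by (rule st_weak_sym_grad_cong[rotated]) (use u in auto)
  qed
  ultimately have 2: "\<exists>g\<in>Lvar (I \<times> S) (time_ext p). st_weak_sym_grad (I \<times> S) (\<lambda>(t, x). \<phi> t *\<^sub>R u x) g"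
    by blast
  have "(\<lambda>x. \<phi> t *\<^sub>R u x) \<in> X_sym S (\<lambda>_. 2) p" for t
  proof -
    obtain K where K: "compact K" "K \<subseteq> S" "\<And>x. v x \<noteq> 0 \<Longrightarrow> x \<in> K"
      using v by (rule Cinf0_support) blast
    have "(\<lambda>x. \<phi> t *\<^sub>R v x) \<in> Cinf0 S"
      by (rule Cinf0I[OF Cinf_on_UNIV_scaleR[OF Cinf_on_UNIV_const smooth] _ K(1,2)]) (use K(3) in auto)
    then have "(\<lambda>x. \<phi> t *\<^sub>R v x) \<in> X_sym S (\<lambda>_. 2) p"
      by (rule Cinf0_subset_X_sym[OF S, where P = 3]) (use p in auto)
    then show ?thesis by (rule X_sym_cong[rotated]) (simp add: u)
  qed
  then have 3: "AE t in lebesgue_on I. (\<lambda>x. (case (t, x) of (t, x) \<Rightarrow> \<phi> t *\<^sub>R u x)) \<in> X_sym S (\<lambda>x. 2) (\<lambda>x. time_ext p (t, x))"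
    by (simp add: time_ext_def)
  show ?thesis using 1 2 3 unfolding calX_sym_def by simp
qed

lemma modular_mono_set:
  assumes "S \<in> sets lebesgue" "S' \<in> sets lebesgue" "S \<subseteq> S'"
  shows "modular S p f \<le> modular S' p f"
  unfolding modular_eq_lebesgue[OF assms(1)] modular_eq_lebesgue[OF assms(2)]
  using assms(3) by (intro nn_integral_mono) (auto simp: indicator_def)

lemma emeasure_lebesgue_open_neq_0:
  fixes U :: "'a::euclidean_space set"
  assumes "open U" "U \<noteq> {}"
  shows "emeasure lebesgue U \<noteq> 0"
proof
  assume "emeasure lebesgue U = 0"
  then have "negligible U" using assms(1) by (simp add: negligible_iff_null_sets null_sets_def)
  then show False using open_not_negligible assms by blast
qed

text \<open>Where both the space factor and the exponent are constant, the modular of the product is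
  a multiple of the modular of the profile. When \<open>A\<close> is nonzero and \<open>B\<close> is
  nonempty and bounded, that multiple is positive and finite, so integrability of the profile can be
  read off.\<close>

lemma modular_tensor_on_plateau:
  fixes w :: "'a::euclidean_space \<Rightarrow> 'b::euclidean_space" and \<phi> :: "real \<Rightarrow> real"
  assumes "open I" and "open B" and \<phi>: "\<phi> \<in> borel_measurable (lebesgue_on I)"
    and w: "\<And>x. x \<in> B \<Longrightarrow> w x = A" and p: "\<And>x. x \<in> B \<Longrightarrow> p x = c"
  shows "modular (I \<times> B) (time_ext p) (\<lambda>(t, x). \<phi> t *\<^sub>R w x) =
    modular I (\<lambda>_. c) \<phi> * (ennreal (norm A powr c) * emeasure lebesgue B)"
proof -
  have sets: "I \<in> sets lebesgue" "B \<in> sets lebesgue" "I \<times> B \<in> sets lebesgue"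
    using assms(1,2) by (auto simp: open_Times)
  have "modular (I \<times> B) (time_ext p) (\<lambda>(t, x). \<phi> t *\<^sub>R w x) =
      modular (I \<times> B) (time_ext p) (\<lambda>(t, x). \<phi> t *\<^sub>R A)"
    by (rule modular_cong) (auto simp: w)
  also have "\<dots> = modular I (\<lambda>_. c) \<phi> * modular B (\<lambda>_. c) (\<lambda>_. A)"
    by (rule modular_tensor[OF sets \<phi>]) (auto simp: p)
  also have "modular B (\<lambda>_. c) (\<lambda>_. A) = ennreal (norm A powr c) * emeasure lebesgue B"
    using sets by (simp add: modular_def emeasure_restrict_space)
  finally show ?thesis .
qed

text \<open>The weak gradient \<open>g\<close> supplied by membership must agree almost everywhere
  over the plateau with \<open>\<phi> t *\<^sub>R A\<close>. Its finite modular therefore bounds a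
  positive multiple of the modular of \<open>\<phi>\<close> with exponent \<open>c\<close>.\<close>

lemma Lvar_if_tensor_in_calX_grad:
  fixes v :: "real^'d::finite \<Rightarrow> real^'d" and \<phi> :: "real \<Rightarrow> real"
  assumes I: "I = {0<..<T}" and "0 < T" and S: "open S" and v: "Cinf_on UNIV v"
    and \<phi>i: "set_integrable lebesgue I \<phi>" and \<phi>m: "\<phi> \<in> borel_measurable (lebesgue_on I)"
    and u: "\<And>x. x \<in> S \<Longrightarrow> u x = v x"
    and box: "cbox a b \<subseteq> S" "box a b \<noteq> {}"
    and A: "\<And>x. x \<in> box a b \<Longrightarrow> grad v x = A" "A \<noteq> 0"
    and p: "\<And>x. x \<in> box a b \<Longrightarrow> p x = c"
    and mem: "(\<lambda>(t, x). \<phi> t *\<^sub>R u x) \<in> calX_grad I S q (time_ext p)"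
  shows "\<phi> \<in> Lvar I (\<lambda>_. c)"
proof -
  let ?Q = "I \<times> S" and ?g' = "\<lambda>(t, x). \<phi> t *\<^sub>R grad v x"
  have oI: "open I" using I by simp
  have oQ: "open ?Q" using oI S by (simp add: open_Times)
  have IB: "I \<times> box a b \<in> sets lebesgue" using oI by (simp add: open_Times open_box)
  obtain g where g: "g \<in> Lvar ?Q (time_ext p)" "st_weak_grad ?Q (\<lambda>(t, x). \<phi> t *\<^sub>R u x) g"
    using mem by (auto simp: calX_grad_def)
  have "st_weak_grad ?Q (\<lambda>(t, x). \<phi> t *\<^sub>R v x) g"
    by (rule st_weak_grad_cong[OF _ g(2)]) (auto simp: u)
  note unique = st_weak_grad_unique[OF oQ this st_weak_grad_tensor[OF \<phi>i oI S v]]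
  \<comment> \<open>Uniqueness is available only on boxes whose closure lies in the cylinder, so the
    time interval is exhausted from inside; countably many boxes keep the exceptional set
    null.\<close>
  have "AE z in lebesgue. z \<in> box (T / real (n + 2), a) (T - T / real (n + 2), b) \<longrightarrow> g z = ?g' z" for n
  proof -
    have "0 < T / real (n + 2)" using \<open>0 < T\<close> by simp
    then have "cbox (T / real (n + 2), a) (T - T / real (n + 2), b) \<subseteq> ?Q"
      unfolding cbox_Pair_eq using box(1)
      by (intro Sigma_mono) (auto simp: I simp del: of_nat_add)
    then show ?thesis by (rule unique)
  qed
  then have "AE z in lebesgue. \<forall>n. z \<in> box (T / real (n + 2), a) (T - T / real (n + 2), b) \<longrightarrow> g z = ?g' z"
    unfolding AE_all_countable by (rule allI)
  then have ae: "AE z in lebesgue. z \<in> I \<times> box a b \<longrightarrow> g z = ?g' z"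
  proof eventually_elim
    case (elim z)
    show ?case
    proof
      assume z: "z \<in> I \<times> box a b"
      then obtain t x where tx: "z = (t, x)" "0 < t" "t < T" "x \<in> box a b" by (auto simp: I)
      define m where "m = min t (T - t)"
      have m: "m > 0" using tx by (simp add: m_def)
      obtain n where "T / m < real n" using reals_Archimedean2 by blast
      then have "T < real n * m" using m by (simp add: field_simps)
      also have "\<dots> \<le> real (n + 2) * m" using m by (simp add: algebra_simps)
      finally have "T / real (n + 2) < m" by (simp add: field_simps)
      then have "z \<in> box (T / real (n + 2), a) (T - T / real (n + 2), b)"
        using tx by (auto simp: mem_box Basis_prod_def m_def)
      then show "g z = ?g' z" using elim by blast
    qed
  qed
  have "modular I (\<lambda>_. c) \<phi> * (ennreal (norm A powr c) * emeasure lebesgue (box a b)) =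
      modular (I \<times> box a b) (time_ext p) ?g'"
    by (rule modular_tensor_on_plateau[OF oI open_box \<phi>m, symmetric]) (auto simp: A p)
  also have "\<dots> = modular (I \<times> box a b) (time_ext p) g"
    unfolding modular_eq_lebesgue[OF IB]
    by (rule nn_integral_cong_AE) (use ae in \<open>eventually_elim, auto simp: indicator_def\<close>)
  also have "\<dots> \<le> modular ?Q (time_ext p) g"
    using oQ box(1) box_subset_cbox[of a b] by (intro modular_mono_set IB) auto
  also have "\<dots> < \<infinity>" using g(1) by (simp add: Lvar_def)
  finally have fin: "modular I (\<lambda>_. c) \<phi> * (ennreal (norm A powr c) * emeasure lebesgue (box a b)) < \<infinity>" .
  have "emeasure lebesgue (box a b) \<noteq> 0"
    by (rule emeasure_lebesgue_open_neq_0[OF open_box box(2)])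
  moreover have "ennreal (norm A powr c) \<noteq> 0" using A(2) by simp
  ultimately have "modular I (\<lambda>_. c) \<phi> < \<infinity>"
    using fin by (auto simp: ennreal_mult_less_top)
  then show ?thesis using \<phi>m by (simp add: Lvar_def)
qed

subsection \<open>Failure of the gradient estimate\<close>

lemma lux_norm_le:
  assumes "0 < l" "modular S p (\<lambda>x. f x /\<^sub>R l) \<le> 1"
  shows "lux_norm S p f \<le> l"
  unfolding lux_norm_def
  by (rule cInf_lower) (use assms in \<open>auto intro: bdd_belowI[of _ 0] less_imp_le\<close>)

text \<open>A lower bound for all admissible scales passes to the infimum only if some scale is
  admissible, since the infimum of the empty set of reals has no useful value. Boundedness of
  \<open>f\<close> on a set of finite measure provides one.\<close>

lemma lux_norm_ge_bounded:
  fixes f :: "'a::euclidean_space \<Rightarrow> 'b::euclidean_space"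
  assumes S: "S \<in> lmeasurable" and bd: "\<And>x. x \<in> S \<Longrightarrow> norm (f x) \<le> M"
    and p: "\<And>x. x \<in> S \<Longrightarrow> 1 \<le> p x"
    and b: "\<And>l. 0 < l \<Longrightarrow> modular S p (\<lambda>x. f x /\<^sub>R l) \<le> 1 \<Longrightarrow> b \<le> l"
  shows "b \<le> lux_norm S p f"
  unfolding lux_norm_def
proof (rule cInf_greatest)
  define m where "m = measure lebesgue S"
  \<comment> \<open>At this scale the function is at most \<open>1 / (m + 1)\<close>, hence at most
    1, so exponents above 1 only decrease it; the modular is then at most
    \<open>m / (m + 1)\<close>.\<close>
  define l where "l = max M 1 * (m + 1)"
  have m: "m \<ge> 0" by (simp add: m_def)
  have l: "l > 0" using m by (simp add: l_def)
  have "norm (f x /\<^sub>R l) powr p x \<le> 1 / (m + 1)" if "x \<in> S" for x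
  proof -
    have "norm (f x /\<^sub>R l) = norm (f x) / l" using l by (simp add: divide_inverse abs_mult mult.commute)
    also have "\<dots> \<le> max M 1 / l" using bd[OF that] l by (intro divide_right_mono) auto
    also have "\<dots> = 1 / (m + 1)" using m by (simp add: l_def)
    finally have le: "norm (f x /\<^sub>R l) \<le> 1 / (m + 1)" .
    also have "\<dots> \<le> 1" using m by simp
    finally have "norm (f x /\<^sub>R l) powr p x \<le> norm (f x /\<^sub>R l) powr 1"
      using p[OF that] by (intro powr_mono') auto
    then show ?thesis using le by simp
  qed
  then have "modular S p (\<lambda>x. f x /\<^sub>R l) \<le> ennreal (1 / (m + 1)) * emeasure lebesgue S"
    using S m by (intro modular_le_bounded) auto
  also have "\<dots> = ennreal (1 / (m + 1) * m)"
    using S m ennreal_mult[of "1 / (m + 1)" m] by (simp add: emeasure_eq_measure2 m_def)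
  also have "\<dots> \<le> 1" using m by (simp add: ennreal_le_1)
  finally show "{l. 0 < l \<and> modular S p (\<lambda>x. f x /\<^sub>R l) \<le> 1} \<noteq> {}" using l by blast
qed (use b in auto)

lemma modular_divide:
  fixes f :: "'a::euclidean_space \<Rightarrow> real"
  assumes "f \<in> borel_measurable (lebesgue_on S)" "0 < l"
  shows "modular S (\<lambda>_. c) (\<lambda>x. f x / l) = ennreal (l powr - c) * modular S (\<lambda>_. c) f"
proof -
  have "norm (f x / l) powr c = l powr - c * norm (f x) powr c" for x
    using assms(2) by (simp add: powr_divide powr_minus field_simps)
  then show ?thesis
    unfolding modular_def using assms(1)
    by (simp add: ennreal_mult nn_integral_cmult)
qed

text \<open>A fixed bump is compressed about the midpoint of the interval by the factor
  \<open>Suc n\<close>. A change of variables divides its modular by that factor for every exponent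
  alike, so the same sequence can be measured with exponent 2 and with exponent 3.\<close>

lemma concentrating_bumps:
  assumes "0 < T"
  shows "\<exists>(\<theta> :: nat \<Rightarrow> real \<Rightarrow> real) N. (\<forall>n. \<theta> n \<in> Cinf0 {0<..<T}) \<and> (\<forall>c::real. 0 < N c) \<and>
    (\<forall>n c. 0 < c \<longrightarrow> modular {0<..<T} (\<lambda>_. c) (\<theta> n) = ennreal (N c / real (Suc n)))"
proof -
  define \<theta>0 where "\<theta>0 = box_bump (- T / 4) (T / 4)"
  have smooth: "Cinf_on UNIV \<theta>0" by (simp add: \<theta>0_def Cinf_on_box_bump)
  have supp: "\<theta>0 t = 0 \<longleftrightarrow> t \<notin> {- T / 4<..<T / 4}" for t
    by (simp add: \<theta>0_def box_bump_eq_0_iff box_real)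
  have nonneg: "0 \<le> \<theta>0 t" for t by (simp add: \<theta>0_def box_bump_nonneg)
  have meas[measurable]: "\<theta>0 \<in> borel_measurable borel"
    by (rule borel_measurable_continuous_onI[OF Cinf_on_UNIV_continuous[OF smooth]])
  obtain M where M: "\<And>t. norm (\<theta>0 t) \<le> M"
    by (rule bounded_if_compact_support[OF Cinf_on_UNIV_continuous[OF smooth], of "{- T / 4..T / 4}"])
      (auto simp: supp)
  define J where "J c = (\<integral>\<^sup>+ t. ennreal (norm (\<theta>0 t) powr c) \<partial>lborel)" for c
  have J_fin: "J c < \<infinity>" if "c > 0" for c
  proof -
    have "J c \<le> (\<integral>\<^sup>+ t. ennreal (M powr c) * indicator {- T / 4<..<T / 4} t \<partial>lborel)"
      unfolding J_def
    proof (rule nn_integral_mono)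
      fix t
      show "ennreal (norm (\<theta>0 t) powr c) \<le> ennreal (M powr c) * indicator {- T / 4<..<T / 4} t"
        using supp[of t] M[of t] that
        by (cases "\<theta>0 t = 0") (auto intro!: ennreal_leI powr_mono2)
    qed
    also have "\<dots> < \<infinity>" using assms by (simp add: nn_integral_cmult ennreal_mult_less_top)
    finally show ?thesis .
  qed
  have J_pos: "J c \<noteq> 0" for c
  proof
    assume "J c = 0"
    then have "AE t in lborel. norm (\<theta>0 t) powr c = 0"
      unfolding J_def by (subst (asm) nn_integral_0_iff_AE) auto
    then have "AE t in lborel. t \<notin> {- T / 4<..<T / 4}"
      by eventually_elim (use supp in auto)
    then have "{- T / 4<..<T / 4} \<in> null_sets lborel"
      by (subst AE_iff_null_sets) simp_all
    then have "emeasure lborel {- T / 4<..<T / 4} = 0" by (rule null_setsD1)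
    then show False using assms by simp
  qed
  \<comment> \<open>The value 1 for other exponents is a mere default, so that positivity holds
    without a side condition.\<close>
  define N where "N c = (if c > 0 then enn2real (J c) else 1)" for c
  \<comment> \<open>The argument is \<open>real (Suc n) * (t - T / 2)\<close>, written in the affine
    form of the substitution rule. As the base bump lives within distance \<open>T / 4\<close> of 0,
    every compressed one lives within \<open>T / 4\<close> of the midpoint.\<close>
  define \<theta> where "\<theta> n t = \<theta>0 (- real (Suc n) * (T / 2) + real (Suc n) * t)" for n t
  have \<theta>_supp: "t \<in> {T / 4..3 * T / 4}" if "\<theta> n t \<noteq> 0" for n t
  proof -
    have "- real (Suc n) * (T / 2) + real (Suc n) * t = real (Suc n) * (t - T / 2)"
      by (simp only: right_diff_distrib)
    then have "real (Suc n) * (t - T / 2) \<in> {- T / 4<..<T / 4}"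
      using that supp[of "real (Suc n) * (t - T / 2)"] unfolding \<theta>_def by metis
    then have "\<bar>real (Suc n) * (t - T / 2)\<bar> < T / 4"
      unfolding abs_less_iff greaterThanLessThan_iff by linarith
    moreover have "\<bar>t - T / 2\<bar> \<le> \<bar>real (Suc n) * (t - T / 2)\<bar>"
      unfolding abs_mult using mult_right_mono[of 1 "real (Suc n)" "\<bar>t - T / 2\<bar>"] by simp
    ultimately show ?thesis by (auto simp: abs_less_iff)
  qed
  show ?thesis
  proof (intro exI[of _ \<theta>] exI[of _ N] conjI allI impI)
    fix n
    have "Cinf_on UNIV (\<lambda>t. - real (Suc n) * (T / 2) + real (Suc n) * t)"
      by (intro Cinf_on_UNIV_add Cinf_on_UNIV_const Cinf_on_UNIV_bounded_linear bounded_linear_mult_right)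
    from Cinf_on_UNIV_compose_real[OF smooth this] have "Cinf_on UNIV (\<theta> n)"
      by (simp add: \<theta>_def[abs_def])
    then show "\<theta> n \<in> Cinf0 {0<..<T}"
      by (rule Cinf0I[where K = "{T / 4..3 * T / 4}"]) (use \<theta>_supp assms in auto)
  next
    show "0 < N c" for c
      using J_fin[of c] J_pos[of c] by (auto simp: N_def enn2real_positive_iff zero_less_iff_neq_zero)
  next
    fix n and c :: real assume c: "0 < c"
    have "modular {0<..<T} (\<lambda>_. c) (\<theta> n) = (\<integral>\<^sup>+ t. ennreal (norm (\<theta> n t) powr c) * indicator {0<..<T} t \<partial>lborel)"
      by (subst modular_eq_lebesgue) (auto simp: nn_integral_completion)
    also have "\<dots> = (\<integral>\<^sup>+ t. ennreal (norm (\<theta> n t) powr c) \<partial>lborel)"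
    proof (rule nn_integral_cong)
      fix t
      show "ennreal (norm (\<theta> n t) powr c) * indicator {0<..<T} t = ennreal (norm (\<theta> n t) powr c)"
        using \<theta>_supp[of n t] assms by (cases "\<theta> n t = 0") auto
    qed
    finally have mod: "modular {0<..<T} (\<lambda>_. c) (\<theta> n) = (\<integral>\<^sup>+ t. ennreal (norm (\<theta> n t) powr c) \<partial>lborel)" .
    have "J c = ennreal (real (Suc n)) * modular {0<..<T} (\<lambda>_. c) (\<theta> n)"
      unfolding J_def mod \<theta>_def
      by (subst nn_integral_real_affine[where c = "real (Suc n)" and t = "- real (Suc n) * (T / 2)"]) auto
    moreover have "J c = ennreal (N c)"
      using J_fin[OF c] c by (simp add: N_def)
    moreover have "ennreal (1 / real (Suc n)) * ennreal (real (Suc n)) = 1"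
      by (subst ennreal_mult[symmetric]) auto
    ultimately have "ennreal (1 / real (Suc n)) * ennreal (N c) = modular {0<..<T} (\<lambda>_. c) (\<theta> n)"
      by (metis mult.assoc mult_1)
    moreover have "ennreal (1 / real (Suc n)) * ennreal (N c) = ennreal (N c / real (Suc n))"
      using c by (subst ennreal_mult[symmetric]) (auto simp: N_def)
    ultimately show "modular {0<..<T} (\<lambda>_. c) (\<theta> n) = ennreal (N c / real (Suc n))" by simp
  qed
qed

text \<open>Concentrating a test function in time by the factor \<open>n\<close> scales the symmetric gradient, which
  lives where \<open>p = 2\<close>, like \<open>n powr (-1/2)\<close>, but the gradient on the plateau \<open>p = 3\<close> only like
  \<open>n powr (-1/3)\<close>.\<close>

lemma no_Korn_constant:
  fixes v :: "real^'d::finite \<Rightarrow> real^'d"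
  assumes I: "I = {0<..<T}" and "0 < T" and S: "open S" "bounded S" and v: "v \<in> Cinf0 S"
    and p1: "\<And>x. 1 \<le> p x" and sym0: "\<And>x. sym_grad v x \<noteq> 0 \<Longrightarrow> p x = 2"
    and box: "box a b \<subseteq> S" "box a b \<noteq> {}"
    and A: "\<And>x. x \<in> box a b \<Longrightarrow> grad v x = A" "A \<noteq> 0"
    and p3: "\<And>x. x \<in> box a b \<Longrightarrow> p x = 3"
  shows "\<not> (\<exists>C>0. \<forall>\<phi>\<in>Cinf0 (I \<times> S).
    lux_norm (I \<times> S) (time_ext p) (st_grad \<phi>) \<le> C * lux_norm (I \<times> S) (time_ext p) (st_sym_grad \<phi>))"
proof
  let ?Q = "I \<times> S" and ?p = "time_ext p"
  assume "\<exists>C>0. \<forall>\<phi>\<in>Cinf0 ?Q. lux_norm ?Q ?p (st_grad \<phi>) \<le> C * lux_norm ?Q ?p (st_sym_grad \<phi>)"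
  then obtain C where C: "C > 0"
    "\<And>\<phi>. \<phi> \<in> Cinf0 ?Q \<Longrightarrow> lux_norm ?Q ?p (st_grad \<phi>) \<le> C * lux_norm ?Q ?p (st_sym_grad \<phi>)" by blast
  from concentrating_bumps[OF \<open>0 < T\<close>] obtain \<theta> :: "nat \<Rightarrow> real \<Rightarrow> real" and N :: "real \<Rightarrow> real" where
    bumps: "(\<forall>n. \<theta> n \<in> Cinf0 I) \<and> (\<forall>c. 0 < N c) \<and>
      (\<forall>n c. 0 < c \<longrightarrow> modular I (\<lambda>_. c) (\<theta> n) = ennreal (N c / real (Suc n)))"
    unfolding I by (elim exE)
  have \<theta>: "\<theta> n \<in> Cinf0 I" and N: "0 < N c"
    and mod\<theta>: "0 < c \<Longrightarrow> modular I (\<lambda>_. c) (\<theta> n) = ennreal (N c / real (Suc n))" for n c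
    using bumps by blast+
  have smooth: "Cinf_on UNIV v" and smooth\<theta>: "Cinf_on UNIV (\<theta> n)" for n
    using v \<theta> by (simp_all add: Cinf0_def)
  have oI: "open I" using I by simp
  have Sm: "S \<in> lmeasurable" using S by (simp add: lmeasurable_open)
  have oQ: "open ?Q" using oI S(1) by (simp add: open_Times)
  have Qm: "?Q \<in> lmeasurable"
    using oQ S(2) I by (intro lmeasurable_open) (auto intro: bounded_Times)
  have sets: "I \<in> sets lebesgue" "S \<in> sets lebesgue" "?Q \<in> sets lebesgue" "I \<times> box a b \<in> sets lebesgue"
    using oI S(1) by (auto simp: open_Times open_box)
  have \<theta>m: "\<theta> n \<in> borel_measurable (lebesgue_on I)" "(\<lambda>t. \<theta> n t / l) \<in> borel_measurable (lebesgue_on I)" for n l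
    using continuous_imp_borel_measurable_lebesgue_on[OF Cinf_on_UNIV_continuous[OF smooth\<theta>]] by auto
  obtain M where M: "\<And>x. norm (grad v x) \<le> M" "\<And>x. norm (sym_grad v x) \<le> M"
    using Cinf0_grad_bounded[OF v] by metis
  have symm: "sym_grad v \<in> borel_measurable (lebesgue_on S)"
    by (rule continuous_imp_borel_measurable_lebesgue_on[OF continuous_on_sym_grad[OF smooth]])
  have "sym_grad v \<in> Lvar S (\<lambda>_. 2)"
    by (rule bounded_in_Lvar[OF Sm symm M(2), where P = 2]) simp
  then obtain m2 where m2: "modular S (\<lambda>_. 2) (sym_grad v) = ennreal m2" "0 \<le> m2"
    by (auto simp: Lvar_def less_top_ennreal)
  define \<beta> where "\<beta> = norm A powr 3 * measure lebesgue (box a b)"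
  have "box a b \<in> lmeasurable" by simp
  then have "emeasure lebesgue (box a b) = ennreal (measure lebesgue (box a b))"
    by (simp add: emeasure_eq_measure2)
  then have \<beta>: "ennreal (norm A powr 3) * emeasure lebesgue (box a b) = ennreal \<beta>" "\<beta> > 0"
    using emeasure_lebesgue_open_neq_0[OF open_box box(2)] A(2)
    by (auto simp: \<beta>_def ennreal_mult zero_less_measure_iff less_le)
  \<comment> \<open>The summand 1 keeps \<open>E\<close> positive without a lower bound on
    \<open>m2\<close>.\<close>
  define E where "E = N 2 * m2 + 1"
  have E: "E > 0" using N[of 2] m2(2) by (simp add: E_def add_nonneg_pos)
  \<comment> \<open>With \<open>k = real (Suc n)\<close>, the assumed estimate compares
    \<open>root 3 (N 3 * \<beta> / k)\<close> with \<open>C * sqrt (E / k)\<close>. The sixth power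
    removes both roots and leaves one factor \<open>k\<close> on the left, while the right side does
    not depend on \<open>n\<close>.\<close>
  have key: "real (Suc n) * (N 3 * \<beta>)\<^sup>2 \<le> C ^ 6 * E ^ 3" for n
  proof -
    define k where "k = real (Suc n)"
    have k: "k > 0" by (simp add: k_def)
    define f where "f = (\<lambda>(t, x). \<theta> n t *\<^sub>R v x)"
    obtain K K' where K: "compact K" "K \<subseteq> I" "\<And>t. \<theta> n t \<noteq> 0 \<Longrightarrow> t \<in> K"
      and K': "compact K'" "K' \<subseteq> S" "\<And>x. v x \<noteq> 0 \<Longrightarrow> x \<in> K'"
      using Cinf0_support[OF \<theta>[of n]] Cinf0_support[OF v] by metis
    have "Cinf_on UNIV (\<lambda>z. \<theta> n (fst z) *\<^sub>R v (snd z))"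
      by (intro Cinf_on_UNIV_scaleR Cinf_on_UNIV_compose_bounded_linear[OF bounded_linear_fst]
          Cinf_on_UNIV_compose_bounded_linear[OF bounded_linear_snd] smooth smooth\<theta>)
    then have f: "f \<in> Cinf0 ?Q"
      by (intro Cinf0I[where K = "K \<times> K'"])
        (use K K' in \<open>auto simp: f_def case_prod_unfold compact_Times\<close>)
    have gradf: "st_grad f = (\<lambda>(t, x). \<theta> n t *\<^sub>R grad v x)"
      and symf: "st_sym_grad f = (\<lambda>(t, x). \<theta> n t *\<^sub>R sym_grad v x)"
      by (auto simp: f_def st_grad_def st_sym_grad_def fun_eq_iff grad_sym_grad_scaleR[OF smooth])
    \<comment> \<open>At this scale the modular is \<open>N 2 * m2 / E\<close>, which is at most 1
      by the choice of \<open>E\<close>.\<close>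
    have "lux_norm ?Q ?p (st_sym_grad f) \<le> sqrt (E / k)"
    proof (rule lux_norm_le)
      define l where "l = sqrt (E / k)"
      show l: "0 < sqrt (E / k)" using E k by simp
      have "modular ?Q ?p (\<lambda>z. st_sym_grad f z /\<^sub>R l) =
          modular ?Q ?p (\<lambda>(t, x). (\<theta> n t / l) *\<^sub>R sym_grad v x)"
        by (rule modular_cong) (auto simp: symf divide_inverse abs_mult mult.commute)
      also have "\<dots> = modular I (\<lambda>_. 2) (\<lambda>t. \<theta> n t / l) * modular S (\<lambda>_. 2) (sym_grad v)"
        by (rule modular_tensor[OF sets(1-3) \<theta>m(2) symm]) (use sym0 in auto)
      also have "\<dots> = ennreal (l powr - 2) * ennreal (N 2 / k) * ennreal m2"
        using l by (simp add: modular_divide[OF \<theta>m(1)] mod\<theta> m2 l_def k_def)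
      also have "\<dots> = ennreal (l powr - 2 * (N 2 / k) * m2)"
        using N[of 2] k m2(2)
        by (simp add: ennreal_mult del: times_divide_eq_left times_divide_eq_right)
      also have "\<dots> \<le> 1"
      proof -
        have "l powr - 2 = k / E"
          using l E k by (simp add: l_def powr_minus powr_numeral)
        then have "l powr - 2 * (N 2 / k) * m2 = N 2 * m2 / E" using k by simp
        also have "\<dots> \<le> 1" using E by (simp add: E_def)
        finally show ?thesis by (simp add: ennreal_le_1)
      qed
      finally show "modular ?Q ?p (\<lambda>z. st_sym_grad f z /\<^sub>R sqrt (E / k)) \<le> 1" by (simp add: l_def)
    qed
    with C(2)[OF f] C(1) have upper: "lux_norm ?Q ?p (st_grad f) \<le> C * sqrt (E / k)"
      by (meson less_eq_real_def mult_left_mono order_trans)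
    obtain M' where M': "\<And>t. norm (\<theta> n t) \<le> M'"
      using bounded_if_compact_support[OF Cinf_on_UNIV_continuous[OF smooth\<theta>] K(1,3)] by metis
    \<comment> \<open>Every admissible scale \<open>l\<close> also makes the modular over the
      plateau at most 1, and that part is exactly
      \<open>l powr - 3 * (N 3 / k) * \<beta>\<close>.\<close>
    have "root 3 (N 3 * \<beta> / k) \<le> lux_norm ?Q ?p (st_grad f)"
    proof (rule lux_norm_ge_bounded[OF Qm])
      show "norm (st_grad f z) \<le> M' * M" for z
        using M'[of "fst z"] M(1)[of "snd z"]
        by (auto simp: gradf case_prod_unfold intro!: mult_mono order_trans[OF norm_ge_zero M'])
      show "1 \<le> ?p z" for z using p1 by (simp add: time_ext_def case_prod_unfold)
      fix l :: real assume l: "0 < l" and le1: "modular ?Q ?p (\<lambda>z. st_grad f z /\<^sub>R l) \<le> 1"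
      have "ennreal (l powr - 3 * (N 3 / k) * \<beta>) = ennreal (l powr - 3) * ennreal (N 3 / k) * ennreal \<beta>"
        using N[of 3] k \<beta>(2)
        by (simp add: ennreal_mult del: times_divide_eq_left times_divide_eq_right)
      also have "\<dots> = modular I (\<lambda>_. 3) (\<lambda>t. \<theta> n t / l) * (ennreal (norm A powr 3) * emeasure lebesgue (box a b))"
        unfolding \<beta>(1) using l by (simp add: modular_divide[OF \<theta>m(1)] mod\<theta> k_def)
      also have "\<dots> = modular (I \<times> box a b) ?p (\<lambda>(t, x). (\<theta> n t / l) *\<^sub>R grad v x)"
        by (rule modular_tensor_on_plateau[OF oI open_box \<theta>m(2), symmetric]) (auto simp: A p3)
      also have "\<dots> = modular (I \<times> box a b) ?p (\<lambda>z. st_grad f z /\<^sub>R l)"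
        by (rule modular_cong) (auto simp: gradf divide_inverse abs_mult mult.commute)
      also have "\<dots> \<le> modular ?Q ?p (\<lambda>z. st_grad f z /\<^sub>R l)"
        by (rule modular_mono_set[OF sets(4,3)]) (use box(1) in auto)
      also have "\<dots> \<le> 1" by (rule le1)
      finally have "l powr - 3 * (N 3 / k) * \<beta> \<le> 1" by (simp add: ennreal_le_1)
      then have "N 3 * \<beta> / k \<le> l ^ 3"
        using l k by (simp add: powr_minus powr_numeral field_simps)
      then have "root 3 (N 3 * \<beta> / k) \<le> root 3 (l ^ 3)" by simp
      then show "root 3 (N 3 * \<beta> / k) \<le> l" using l by (simp add: real_root_power_cancel)
    qed
    with upper have "root 3 (N 3 * \<beta> / k) \<le> C * sqrt (E / k)" by simp
    moreover have pos: "0 \<le> N 3 * \<beta> / k" using N[of 3] \<beta>(2) k by simp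
    ultimately have "root 3 (N 3 * \<beta> / k) ^ 6 \<le> (C * sqrt (E / k)) ^ 6"
      by (intro power_mono) simp_all
    moreover have "root 3 (N 3 * \<beta> / k) ^ 6 = (N 3 * \<beta> / k)\<^sup>2"
      using power_mult[of "root 3 (N 3 * \<beta> / k)" 3 2] pos by simp
    moreover have "(C * sqrt (E / k)) ^ 6 = C ^ 6 * (E / k) ^ 3"
      using power_mult[of "sqrt (E / k)" 2 3] E k by (simp add: power_mult_distrib)
    ultimately have "(N 3 * \<beta> / k)\<^sup>2 * k ^ 3 \<le> C ^ 6 * (E / k) ^ 3 * k ^ 3"
      using k by (simp add: mult_right_mono)
    then show ?thesis unfolding k_def[symmetric]
      using k by (simp add: power_divide power2_eq_square power3_eq_cube field_simps)
  qed
  have pos: "(N 3 * \<beta>)\<^sup>2 > 0" using N[of 3] \<beta>(2) by simp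
  obtain n where "C ^ 6 * E ^ 3 / (N 3 * \<beta>)\<^sup>2 < real n" using reals_Archimedean2 by blast
  then have "C ^ 6 * E ^ 3 < real n * (N 3 * \<beta>)\<^sup>2" using pos by (simp add: field_simps)
  also have "\<dots> \<le> real (Suc n) * (N 3 * \<beta>)\<^sup>2" using pos by simp
  finally show False using key[of n] by simp
qed

subsection \<open>The exponent\<close>

text \<open>The transition is \<open>a / (a + b)\<close>, where \<open>a\<close> vanishes exactly
  outside the ball of radius \<open>r\<close> and \<open>b\<close> exactly on the closed ball of
  half the radius. No point lies in both zero sets, so the denominator is positive.\<close>

lemma plateau_exponent_exists:
  fixes x0 :: "'a::euclidean_space"
  assumes "0 < r"
  shows "\<exists>p. Cinf_on UNIV p \<and> (\<forall>x. 2 \<le> p x \<and> p x \<le> (3::real)) \<and>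
    (\<forall>x\<in>cball x0 (r / 2). p x = 3) \<and> (\<forall>x. x \<notin> ball x0 r \<longrightarrow> p x = 2)"
proof -
  \<comment> \<open>The squared distance is used because the distance itself is not smooth at the
    centre.\<close>
  define s where "s x = (x - x0) \<bullet> (x - x0)" for x
  have s: "s x = (dist x0 x)\<^sup>2" for x
    by (metis dist_norm dist_commute power2_norm_eq_inner s_def)
  have "Cinf_on UNIV s" unfolding s_def
    by (intro Cinf_on_UNIV_bilinear[OF bounded_bilinear_inner] Cinf_on_UNIV_diff Cinf_on_UNIV_const
        Cinf_on_UNIV_bounded_linear bounded_linear_ident)
  note smooth = Cinf_on_UNIV_compose_real[OF Cinf_on_flat_exp Cinf_on_UNIV_diff[OF Cinf_on_UNIV_const this]]
    Cinf_on_UNIV_compose_real[OF Cinf_on_flat_exp Cinf_on_UNIV_diff[OF this Cinf_on_UNIV_const]]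
  define a b where "a x = flat_exp 0 (r\<^sup>2 - s x)" and "b x = flat_exp 0 (s x - (r / 2)\<^sup>2)" for x
  have ab: "Cinf_on UNIV a" "Cinf_on UNIV b" unfolding a_def b_def by (rule smooth)+
  have nonneg: "0 \<le> a x" "0 \<le> b x" for x by (simp_all add: a_def b_def flat_exp_nonneg)
  have a0: "a x = 0 \<longleftrightarrow> x \<notin> ball x0 r" for x
  proof -
    have "a x = 0 \<longleftrightarrow> r\<^sup>2 \<le> (dist x0 x)\<^sup>2" by (simp add: a_def flat_exp_eq_0_iff s)
    also have "\<dots> \<longleftrightarrow> r \<le> dist x0 x" using assms by (simp add: power2_le_iff_abs_le abs_le_square_iff[symmetric])
    finally show ?thesis by (simp add: not_less)
  qed
  have b0: "b x = 0 \<longleftrightarrow> x \<in> cball x0 (r / 2)" for x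
  proof -
    have "b x = 0 \<longleftrightarrow> (dist x0 x)\<^sup>2 \<le> (r / 2)\<^sup>2" by (simp add: b_def flat_exp_eq_0_iff s)
    also have "\<dots> \<longleftrightarrow> dist x0 x \<le> r / 2" using assms by (simp add: abs_le_square_iff[symmetric])
    finally show ?thesis by simp
  qed
  have pos: "0 < a x + b x" for x
  proof -
    have "a x \<noteq> 0 \<or> b x \<noteq> 0" using assms by (auto simp: a0 b0)
    then show ?thesis using nonneg[of x] by linarith
  qed
  define p where "p x = 2 + a x * inverse (a x + b x)" for x
  have "Cinf_on UNIV p" unfolding p_def
    by (intro Cinf_on_UNIV_add Cinf_on_UNIV_const Cinf_on_UNIV_mult Cinf_on_UNIV_inverse ab)
      (use pos in \<open>auto simp: less_imp_neq[THEN not_sym]\<close>)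
  moreover have "2 \<le> p x \<and> p x \<le> 3" for x
    using nonneg[of x] pos[of x] by (auto simp: p_def field_simps)
  moreover have "p x = 3" if "x \<in> cball x0 (r / 2)" for x
  proof -
    have "b x = 0" using that b0 by blast
    then show ?thesis using pos[of x] by (simp add: p_def)
  qed
  moreover have "p x = 2" if "x \<notin> ball x0 r" for x
  proof -
    have "a x = 0" using that a0 by blast
    then show ?thesis by (simp add: p_def)
  qed
  ultimately show ?thesis by blast
qed

text \<open>A nonempty open set has positive measure, so an upper bound attained on one cannot be
  lowered by discarding a null set.\<close>

lemma esssup_lebesgue_on_eq:
  fixes f :: "'a::euclidean_space \<Rightarrow> ereal"
  assumes f: "f \<in> borel_measurable (lebesgue_on S)" and S: "S \<in> sets lebesgue"
    and le: "\<And>x. x \<in> S \<Longrightarrow> f x \<le> c"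
    and U: "open U" "U \<noteq> {}" "U \<subseteq> S" "\<And>x. x \<in> U \<Longrightarrow> f x = c"
  shows "esssup (lebesgue_on S) f = c"
proof (rule antisym)
  show "esssup (lebesgue_on S) f \<le> c"
    using le by (intro esssup_I f) (auto intro!: AE_I2)
  show "c \<le> esssup (lebesgue_on S) f"
  proof (rule ccontr)
    assume lt: "\<not> c \<le> esssup (lebesgue_on S) f"
    have "AE x in lebesgue. x \<in> S \<longrightarrow> f x \<le> esssup (lebesgue_on S) f"
      using esssup_AE[of f "lebesgue_on S"] S by (subst (asm) AE_restrict_space_iff) auto
    then have "AE x in lebesgue. x \<notin> U"
      by eventually_elim (use lt U(3,4) in auto)
    then have "U \<in> null_sets lebesgue"
      using U(1) by (subst AE_iff_null_sets) auto
    then show False using emeasure_lebesgue_open_neq_0[OF U(1,2)] by auto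
  qed
qed

lemma exp_plus_minus_time_ext:
  fixes p :: "'a::euclidean_space \<Rightarrow> real"
  assumes "open I" "I \<noteq> {}" "open S" and p: "continuous_on UNIV p" "\<And>x. m \<le> p x \<and> p x \<le> M"
    and U: "open U" "U \<noteq> {}" "U \<subseteq> S" "\<And>x. x \<in> U \<Longrightarrow> p x = m"
    and V: "open V" "V \<noteq> {}" "V \<subseteq> S" "\<And>x. x \<in> V \<Longrightarrow> p x = M"
  shows "exp_minus (I \<times> S) (time_ext p) = m" and "exp_plus (I \<times> S) (time_ext p) = M"
proof -
  let ?Q = "(I::real set) \<times> S"
  have Q: "?Q \<in> sets lebesgue" using assms(1,3) by (simp add: open_Times)
  have "continuous_on UNIV (time_ext p :: real \<times> 'a \<Rightarrow> real)"
    unfolding time_ext_def case_prod_unfold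
    by (intro continuous_on_compose2[OF p(1)] continuous_intros) auto
  then have [measurable]: "time_ext p \<in> borel_measurable (lebesgue_on ?Q)"
    by (rule continuous_imp_borel_measurable_lebesgue_on)
  have meas: "(\<lambda>z. ereal (time_ext p z)) \<in> borel_measurable (lebesgue_on ?Q)"
    "(\<lambda>z. - ereal (time_ext p z)) \<in> borel_measurable (lebesgue_on ?Q)"
    by measurable
  have "esssup (lebesgue_on ?Q) (\<lambda>z. ereal (time_ext p z)) = ereal M"
    by (rule esssup_lebesgue_on_eq[OF meas(1) Q, where U = "I \<times> V"])
      (use assms in \<open>auto simp: open_Times time_ext_def\<close>)
  then show "exp_plus ?Q (time_ext p) = M" by (simp add: exp_plus_def)
  have "esssup (lebesgue_on ?Q) (\<lambda>z. - ereal (time_ext p z)) = - ereal m"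
    by (rule esssup_lebesgue_on_eq[OF meas(2) Q, where U = "I \<times> U"])
      (use assms in \<open>auto simp: open_Times time_ext_def\<close>)
  then show "exp_minus ?Q (time_ext p) = m" by (simp add: exp_minus_def)
qed

text \<open>A witness that some profile is square integrable but not cube integrable, without which
  the two space-time spaces could not be told apart: the square is \<open>t powr (-2/3)\<close>,
  integrable at 0, and the cube is \<open>1 / t\<close>, which is not.\<close>

lemma powr_in_Lvar_2_minus_Lvar_3:
  assumes "0 < (T::real)"
  shows "(\<lambda>t. t powr (-1/3)) \<in> Lvar {0<..<T} (\<lambda>_. 2) - Lvar {0<..<T} (\<lambda>_. 3)"
proof -
  let ?I = "{0<..<T}" and ?f = "\<lambda>t::real. t powr (-1/3)"
  have I: "?I \<in> sets lebesgue" by simp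
  have "?f \<in> borel_measurable borel" by measurable
  then have meas: "?f \<in> borel_measurable (lebesgue_on ?I)"
    by (intro measurable_restrict_space1 measurable_completion) simp
  have pow: "norm (?f t) powr c = t powr (- c / 3)" for t c
    by (simp add: powr_powr)
  have mod: "modular ?I (\<lambda>_. c) ?f = (\<integral>\<^sup>+ t. ennreal (t powr (- c / 3)) * indicator ?I t \<partial>lborel)" for c
    unfolding modular_eq_lebesgue[OF I] pow nn_integral_completion ..
  have "modular ?I (\<lambda>_. 2) ?f < \<infinity>"
  proof -
    have "((\<lambda>t. t powr (- 2 / 3)) has_integral (T powr (- 2 / 3 + 1) / (- 2 / 3 + 1))) {0..T}"
      by (rule has_integral_powr_from_0) (use assms in auto)
    then have "((\<lambda>t. if t \<in> {0..T} then t powr (- 2 / 3) else 0) has_integral (T powr (- 2 / 3 + 1) / (- 2 / 3 + 1))) UNIV"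
      by (simp only: has_integral_restrict_UNIV)
    then have "(\<integral>\<^sup>+ t. ennreal (if t \<in> {0..T} then t powr (- 2 / 3) else 0) \<partial>lborel) = ennreal (T powr (- 2 / 3 + 1) / (- 2 / 3 + 1))"
      by (intro nn_integral_has_integral_lborel) auto
    moreover have "modular ?I (\<lambda>_. 2) ?f \<le> (\<integral>\<^sup>+ t. ennreal (if t \<in> {0..T} then t powr (- 2 / 3) else 0) \<partial>lborel)"
      unfolding mod by (intro nn_integral_mono) (auto simp: indicator_def)
    ultimately show ?thesis by (simp add: le_less_trans)
  qed
  moreover have "\<not> modular ?I (\<lambda>_. 3) ?f < \<infinity>"
  proof
    assume fin: "modular ?I (\<lambda>_. 3) ?f < \<infinity>"
    have ge: "ennreal (real n) \<le> modular ?I (\<lambda>_. 3) ?f" for n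
    proof -
      \<comment> \<open>The endpoint is chosen so that the integral of \<open>1 / t\<close> from
        \<open>d\<close> to \<open>T / 2\<close> is exactly \<open>n\<close>.\<close>
      define d where "d = T / 2 * exp (- real n)"
      have d: "0 < d" "d \<le> T / 2" using assms by (simp_all add: d_def)
      have "ln d = ln (T / 2) - real n"
        unfolding d_def using assms by (subst ln_mult) auto
      then have "ennreal (real n) = ennreal (ln (T / 2) - ln d)" by simp
      also have "\<dots> = (\<integral>\<^sup>+ t. ennreal (1 / t) * indicator {d..T / 2} t \<partial>lborel)"
        by (rule nn_integral_FTC_Icc[symmetric])
          (use d in \<open>auto intro!: derivative_eq_intros\<close>)
      also have "\<dots> \<le> modular ?I (\<lambda>_. 3) ?f"
        unfolding mod using d assms
        by (intro nn_integral_mono) (auto simp: indicator_def powr_minus_divide intro!: ennreal_leI)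
      finally show ?thesis .
    qed
    obtain y where y: "modular ?I (\<lambda>_. 3) ?f = ennreal y" "0 \<le> y"
      using fin by (auto simp: less_top_ennreal)
    obtain n where "y < real n" using reals_Archimedean2 by blast
    then show False using ge[of n] y by (simp add: ennreal_le_iff)
  qed
  ultimately show ?thesis using meas by (simp add: Lvar_def)
qed

lemma grad_localized_linear:
  assumes "open G" "x \<in> G" "\<And>y. y \<in> G \<Longrightarrow> v y = A *v y"
  shows "grad v x = A"
proof -
  have "((\<lambda>y. A *v y) has_derivative (\<lambda>y. A *v y)) (at x)"
    by (rule bounded_linear_imp_has_derivative[OF matrix_vector_mul_bounded_linear])
  then have "(v has_derivative (\<lambda>y. A *v y)) (at x)"
    by (rule has_derivative_transform_within_open[OF _ assms(1,2)]) (simp add: assms(3))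
  from frechet_derivative_at[OF this, symmetric] show ?thesis
    by (simp add: grad_def jacobian_def)
qed

theorem mainTheorem3:
  fixes \<Omega> G :: "(real^'d::finite) set" and T :: real and I :: "real set"
    and Q :: "(real \<times> (real^'d)) set" and \<eta> :: "real^'d \<Rightarrow> real"
    and A :: "real^'d^'d" and u :: "real^'d \<Rightarrow> real^'d"
  assumes "CARD('d) \<ge> 2"
    and "open \<Omega>" "connected \<Omega>" "\<Omega> \<noteq> {}" "bounded \<Omega>"
    and "0 < T" and "I = {0<..<T}" and "Q = I \<times> \<Omega>"
    and "open G" "connected G" "G \<noteq> {}" "compact (closure G)" "closure G \<subseteq> \<Omega>"
    and "\<eta> \<in> Cinf0 \<Omega>" and "\<forall>x\<in>G. \<eta> x = 1"
    and "A \<noteq> 0" and "transpose A = - A"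
    and "\<forall>x\<in>\<Omega>. u x = \<eta> x *\<^sub>R (A *v x)"
  shows "\<exists>p :: real^'d \<Rightarrow> real. Cinf_on UNIV p \<and>
    (let pt = time_ext p; pm = exp_minus Q pt; pp = exp_plus Q pt in
      1 < pm \<and>
      \<not> (\<exists>c>0. \<forall>\<phi>\<in>Cinf0 Q. lux_norm Q pt (st_grad \<phi>) \<le> c * lux_norm Q pt (st_sym_grad \<phi>)) \<and>
      (\<forall>\<phi> :: real \<Rightarrow> real. \<phi> \<in> Lvar I (\<lambda>_. pm) - Lvar I (\<lambda>_. pp) \<longrightarrow>
        (\<lambda>(t, x). \<phi> t *\<^sub>R u x) \<in> calX_sym I \<Omega> (\<lambda>_. pm) pt - calX_grad I \<Omega> (\<lambda>_. pm) pt) \<and>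
      calX_sym I \<Omega> (\<lambda>_. pm) pt \<noteq> calX_grad I \<Omega> (\<lambda>_. pm) pt)"
proof -
  note I = \<open>I = {0<..<T}\<close> and \<Omega> = \<open>open \<Omega>\<close> \<open>bounded \<Omega>\<close>
  \<comment> \<open>The values of \<open>u\<close> outside the domain are arbitrary;
    \<open>v\<close> inherits compact support and smoothness on the whole space from
    \<open>\<eta>\<close>.\<close>
  define v where "v x = \<eta> x *\<^sub>R (A *v x)" for x
  have uv: "u x = v x" if "x \<in> \<Omega>" for x using assms(18) that by (simp add: v_def)
  have G\<Omega>: "G \<subseteq> \<Omega>" using \<open>closure G \<subseteq> \<Omega>\<close> closure_subset by blast
  have v: "v \<in> Cinf0 \<Omega>"
  proof -
    obtain K where K: "compact K" "K \<subseteq> \<Omega>" "\<And>x. \<eta> x \<noteq> 0 \<Longrightarrow> x \<in> K" "Cinf_on UNIV \<eta>"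
      using \<open>\<eta> \<in> Cinf0 \<Omega>\<close> by (rule Cinf0_support) blast
    have "Cinf_on UNIV v" unfolding v_def
      by (intro Cinf_on_UNIV_scaleR K(4) Cinf_on_UNIV_bounded_linear matrix_vector_mul_bounded_linear)
    then show ?thesis by (rule Cinf0I[OF _ _ K(1,2)]) (use K(3) in \<open>auto simp: v_def\<close>)
  qed
  then have smooth: "Cinf_on UNIV v" by (simp add: Cinf0_def)
  have grad_v: "grad v x = A" if "x \<in> G" for x
    by (rule grad_localized_linear[OF \<open>open G\<close> that]) (use \<open>\<forall>x\<in>G. \<eta> x = 1\<close> in \<open>simp add: v_def\<close>)
  have sym_v: "sym_grad v x = 0" if "x \<in> G" for x
    by (simp add: sym_grad_def grad_v[OF that] \<open>transpose A = - A\<close>)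
  obtain x0 where "x0 \<in> G" using \<open>G \<noteq> {}\<close> by blast
  then obtain e where e: "e > 0" "ball x0 e \<subseteq> G" using \<open>open G\<close> openE by blast
  \<comment> \<open>Half of the available radius is kept free: on the shell between radii
    \<open>r\<close> and \<open>e\<close>, inside \<open>G\<close>, the exponent is 2, so its
    infimum is attained on an open subset of the domain.\<close>
  define r where "r = e / 2"
  have r: "r > 0" "ball x0 r \<subseteq> G" using e by (auto simp: r_def)
  from plateau_exponent_exists[OF r(1), of x0] obtain p :: "real^'d \<Rightarrow> real" where p: "Cinf_on UNIV p"
    "\<And>x. 2 \<le> p x \<and> p x \<le> 3" "\<And>x. x \<in> cball x0 (r / 2) \<Longrightarrow> p x = 3" "\<And>x. x \<notin> ball x0 r \<Longrightarrow> p x = 2"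
    by blast
  \<comment> \<open>The exponent leaves the value 2 only inside a ball contained in
    \<open>G\<close>, where skew-symmetry makes the symmetric gradient vanish.\<close>
  have sym_p: "p x = 2" if "sym_grad v x \<noteq> 0" for x
    using that sym_v[of x] r(2) p(4)[of x] by blast
  \<comment> \<open>The plateau is replaced by a box, the shape for which uniqueness of weak
    gradients was established.\<close>
  obtain a b where ab: "cbox a b \<subseteq> ball x0 (r / 2)" "x0 \<in> box a b"
    using open_contains_cbox[of "ball x0 (r / 2)" x0] r(1) by (metis centre_in_ball half_gt_zero open_ball)
  have half: "ball x0 (r / 2) \<subseteq> cball x0 (r / 2)" "ball x0 (r / 2) \<subseteq> ball x0 r"
    using r(1) by auto
  have box: "cbox a b \<subseteq> \<Omega>" "box a b \<noteq> {}" "box a b \<subseteq> \<Omega>" "box a b \<subseteq> G" "box a b \<subseteq> cball x0 (r / 2)"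
    using ab half r(2) G\<Omega> box_subset_cbox[of a b] by blast+
  have exps: "exp_minus Q (time_ext p) = 2" "exp_plus Q (time_ext p) = 3"
  proof -
    \<comment> \<open>The length lies strictly between \<open>r\<close> and
      \<open>e = 2 * r\<close>, so the shell is nonempty.\<close>
    obtain y :: "real^'d" where y: "norm y = 3 * r / 2" using vector_choose_size[of "3 * r / 2"] r(1) by auto
    have "dist x0 (x0 + y) = 3 * r / 2" using y by (simp add: dist_norm)
    then have "x0 + y \<in> ball x0 e - cball x0 r" using r(1) by (simp add: r_def)
    then have U: "open (ball x0 e - cball x0 r)" "ball x0 e - cball x0 r \<noteq> {}" "ball x0 e - cball x0 r \<subseteq> \<Omega>"
      "\<And>x. x \<in> ball x0 e - cball x0 r \<Longrightarrow> p x = 2"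
      using e(2) G\<Omega> p(4) by (auto simp: open_Diff)
    have ne: "open I" "I \<noteq> {}" using I \<open>0 < T\<close> by auto
    have p3: "\<And>x. x \<in> box a b \<Longrightarrow> p x = 3" using p(3) box(5) by blast
    show "exp_minus Q (time_ext p) = 2" "exp_plus Q (time_ext p) = 3"
      unfolding \<open>Q = I \<times> \<Omega>\<close>
      using exp_plus_minus_time_ext[OF ne \<Omega>(1) Cinf_on_UNIV_continuous[OF p(1)] p(2) U open_box box(2,3) p3]
      by auto
  qed
  have strict: "(\<lambda>(t, x). \<phi> t *\<^sub>R u x) \<in> calX_sym I \<Omega> (\<lambda>_. 2) (time_ext p) - calX_grad I \<Omega> (\<lambda>_. 2) (time_ext p)"
    if \<phi>: "\<phi> \<in> Lvar I (\<lambda>_. 2) - Lvar I (\<lambda>_. 3)" for \<phi> :: "real \<Rightarrow> real"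
  proof
    show "(\<lambda>(t, x). \<phi> t *\<^sub>R u x) \<in> calX_sym I \<Omega> (\<lambda>_. 2) (time_ext p)"
    proof (rule tensor_in_calX_sym[OF I \<Omega> v _ sym_p _ uv])
      show "0 \<le> p x \<and> p x \<le> 3" for x using p(2)[of x] by simp
    qed (use \<phi> in auto)
    show "(\<lambda>(t, x). \<phi> t *\<^sub>R u x) \<notin> calX_grad I \<Omega> (\<lambda>_. 2) (time_ext p)"
    proof
      assume mem: "(\<lambda>(t, x). \<phi> t *\<^sub>R u x) \<in> calX_grad I \<Omega> (\<lambda>_. 2) (time_ext p)"
      have "\<phi> \<in> borel_measurable (lebesgue_on I)" using \<phi> by (auto simp: Lvar_def)
      moreover have "set_integrable lebesgue I \<phi>"
        using \<phi> I by (intro set_integrable_if_Lvar_2) auto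
      moreover have "grad v x = A" "p x = 3" if "x \<in> box a b" for x
        using that box(4,5) grad_v p(3) by blast+
      ultimately have "\<phi> \<in> Lvar I (\<lambda>_. 3)"
        using Lvar_if_tensor_in_calX_grad[OF I \<open>0 < T\<close> \<Omega>(1) smooth _ _ uv box(1,2) _ \<open>A \<noteq> 0\<close> _ mem] by blast
      then show False using \<phi> by blast
    qed
  qed
  have no_const: "\<not> (\<exists>c>0. \<forall>\<phi>\<in>Cinf0 Q. lux_norm Q (time_ext p) (st_grad \<phi>) \<le> c * lux_norm Q (time_ext p) (st_sym_grad \<phi>))"
    unfolding \<open>Q = I \<times> \<Omega>\<close>
  proof (rule no_Korn_constant[OF I \<open>0 < T\<close> \<Omega> v _ sym_p box(3,2) _ \<open>A \<noteq> 0\<close>])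
    show "1 \<le> p x" for x using p(2)[of x] by simp
    show "grad v x = A" "p x = 3" if "x \<in> box a b" for x
      using that box(4,5) grad_v p(3) by blast+
  qed
  have "calX_sym I \<Omega> (\<lambda>_. 2) (time_ext p) \<noteq> calX_grad I \<Omega> (\<lambda>_. 2) (time_ext p)"
    using strict powr_in_Lvar_2_minus_Lvar_3[OF \<open>0 < T\<close>] unfolding I by blast
  then show ?thesis
    unfolding Let_def using p(1) exps strict no_const by (intro exI[of _ p]) simp
qed

end
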